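(* Let $\rho\ge0$. Given $\sigma\in W^{1,1}(0,T;\mathbb R^{3\times3}_{\rm sym})$ and $(\varepsilon_0,z_0)\in S(0)$, there exists an energetic solution $(\varepsilon,z):[0,T]\to\mathbb R^{3\times3}_{\rm sym}\times\mathbb R^{3\times3}_{\rm dev}$ such that $(\varepsilon(0),z(0))=(\varepsilon_0,z_0)$; that is, $t\mapsto\dot\sigma(t):\varepsilon(t)$ is integrable and for all $t\in[0,T]$ one has $(\varepsilon(t),z(t))\in S(t)$ and $$W_\rho(\varepsilon(t),z(t))-\sigma(t):\varepsilon(t)+\mathrm{Diss}_D(z,[0,t])=W_\rho(\varepsilon_0,z_0)-\sigma(0):\varepsilon_0-\int_0^t\dot\sigma(s):\varepsilon(s)\,ds .$$ Moreover $(\varepsilon,z)\in W^{1,1}(0,T;\mathbb R^{3\times3}_{\rm sym}\times\mathbb R^{3\times3}_{\rm dev})$.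
   Context: $\mathbb R^{3\times3}_{\rm sym}$ is the space of symmetric $3\times3$ matrices with $a:b=\mathrm{tr}(ab)$ and norm $|\cdot|$; $\mathbb R^{3\times3}_{\rm dev}$ is its trace-free subspace. $\mathbb C:\mathbb R^{3\times3}_{\rm sym}\to\mathbb R^{3\times3}_{\rm sym}$ is linear, symmetric, positive definite, and leaves $\mathbb R^{3\times3}_{\rm dev}$ and $\mathbb R 1_2$ ($1_2$ the identity matrix) invariant. $c_1,c_2,c_3>0$ are constants. $F_0(a)=c_1|a|+c_2|a|^2+I(a)$ for $a\in\mathbb R^{3\times3}_{\rm dev}$, with $I(a)=0$ if $|a|\le c_3$ and $+\infty$ otherwise. For $\rho>0$, $F_\rho:\mathbb R^{3\times3}_{\rm dev}\to[0,\infty)$ is $C^{2,1}$ with $\nabla^2F_\rho$ bounded and Lipschitz, $\nabla^2F_\rho\ge c_2\,\mathrm{Id}$ and $F_\rho(0)=0$. $W_\rho(\varepsilon,z)=\frac12\mathbb C(\varepsilon-z):(\varepsilon-z)+F_\rho(z)$. $D:\mathbb R^{3\times3}_{\rm dev}\to[0,\infty)$ is lower semicontinuous, positively 1-homogeneous, satisfies $D(b+c)\le D(b)+D(c)$ and $D(a)\ge c_D|a|$ for some $c_D>0$. $\mathrm{Diss}_D(z,[s,t])=\sup\sum_{i=1}^ND(z(t_i)-z(t_{i-1}))$ over all finite partitions $s=t_0<\dots<t_N=t$. Stable states: $S(t)=\{(\varepsilon,z)\in\mathbb R^{3\times3}_{\rm sym}\times\mathbb R^{3\times3}_{\rm dev}: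 W_\rho(\varepsilon,z)-\sigma(t):\varepsilon\le W_\rho(\bar\varepsilon,\bar z)-\sigma(t):\bar\varepsilon+D(\bar z-z)\ \forall(\bar\varepsilon,\bar z)\in\mathbb R^{3\times3}_{\rm sym}\times\mathbb R^{3\times3}_{\rm dev}\}$. *)

theory Defs
  imports "HOL-Analysis.Analysis"
begin

type_synonym mat3 = "real^3^3"

definition Sym :: "mat3 set" where
  "Sym = {a. transpose a = a}"

definition Dev :: "mat3 set" where
  "Dev = {a \<in> Sym. trace a = 0}"

definition ddot :: "mat3 \<Rightarrow> mat3 \<Rightarrow> real" where
  "ddot a b = trace (a ** b)"

(* The next two lemmas identify the library inner product and norm of real^3^3,
   restricted to Sym, with a:b = tr(ab) and |a|. *)
lemma ddot_eq_inner:
  assumes "a \<in> Sym"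
  shows "ddot a b = a \<bullet> b"
proof -
  have sym: "a $ i $ k = a $ k $ i" for i k
    using assms by (metis (mono_tags, lifting) Sym_def mem_Collect_eq transpose_def vec_lambda_beta)
  have "ddot a b = (\<Sum>i\<in>UNIV. \<Sum>k\<in>UNIV. a $ i $ k * b $ k $ i)"
    by (simp add: ddot_def trace_def matrix_matrix_mult_def)
  also have "\<dots> = (\<Sum>k\<in>UNIV. \<Sum>i\<in>UNIV. a $ i $ k * b $ k $ i)"
    by (rule sum.swap)
  also have "\<dots> = a \<bullet> b"
    unfolding inner_vec_def by (intro sum.cong refl) (simp add: sym)
  finally show ?thesis .
qed

lemma norm_eq_sqrt_ddot: "a \<in> Sym \<Longrightarrow> norm a = sqrt (ddot a a)"
  by (simp add: ddot_eq_inner norm_eq_sqrt_inner)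

(* Maps on Sym or Dev are total functions on real^3^3; only their values on the
   respective subspace are constrained or used. *)
definition elasticity_tensor :: "(mat3 \<Rightarrow> mat3) \<Rightarrow> bool" where
  "elasticity_tensor C \<longleftrightarrow>
     C ` Sym \<subseteq> Sym \<and>
     (\<forall>a\<in>Sym. \<forall>b\<in>Sym. C (a + b) = C a + C b) \<and>
     (\<forall>r. \<forall>a\<in>Sym. C (r *\<^sub>R a) = r *\<^sub>R C a) \<and>
     (\<forall>a\<in>Sym. \<forall>b\<in>Sym. ddot (C a) b = ddot a (C b)) \<and>
     (\<forall>a\<in>Sym. a \<noteq> 0 \<longrightarrow> ddot (C a) a > 0) \<and>
     C ` Dev \<subseteq> Dev \<and>
     C ` span {mat 1} \<subseteq> span {mat 1}"

definition F0 :: "real \<Rightarrow> real \<Rightarrow> real \<Rightarrow> mat3 \<Rightarrow> ereal" where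
  "F0 c1 c2 c3 a =
     ereal (c1 * norm a + c2 * (norm a)\<^sup>2) + (if norm a \<le> c3 then 0 else \<infinity>)"

(* f maps Dev to [0,\<infinity>) and is C^{2,1} there; g and H are its gradient and Hessian,
   taken along the subspace Dev. Bounds on H are in the operator norm. *)
definition regular_hardening :: "real \<Rightarrow> (mat3 \<Rightarrow> real) \<Rightarrow> bool" where
  "regular_hardening c2 f \<longleftrightarrow>
     (\<forall>a\<in>Dev. f a \<ge> 0) \<and> f 0 = 0 \<and>
     (\<exists>(g :: mat3 \<Rightarrow> mat3) (H :: mat3 \<Rightarrow> mat3 \<Rightarrow> mat3) M L.
        (\<forall>a\<in>Dev. g a \<in> Dev \<and> (f has_derivative (\<lambda>h. ddot (g a) h)) (at a within Dev)) \<and>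
        (\<forall>a\<in>Dev. H a ` Dev \<subseteq> Dev \<and> (g has_derivative H a) (at a within Dev)) \<and>
        (\<forall>a\<in>Dev. \<forall>h\<in>Dev. norm (H a h) \<le> M * norm h) \<and>
        (\<forall>a\<in>Dev. \<forall>b\<in>Dev. \<forall>h\<in>Dev. norm (H a h - H b h) \<le> L * norm (a - b) * norm h) \<and>
        (\<forall>a\<in>Dev. \<forall>h\<in>Dev. ddot (H a h) h \<ge> c2 * (norm h)\<^sup>2))"

definition hardening ::
    "real \<Rightarrow> real \<Rightarrow> real \<Rightarrow> (real \<Rightarrow> mat3 \<Rightarrow> real) \<Rightarrow> real \<Rightarrow> mat3 \<Rightarrow> ereal" where
  "hardening c1 c2 c3 Freg \<rho> a = (if \<rho> = 0 then F0 c1 c2 c3 a else ereal (Freg \<rho> a))"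

definition stored_energy :: "(mat3 \<Rightarrow> mat3) \<Rightarrow> (mat3 \<Rightarrow> ereal) \<Rightarrow> mat3 \<Rightarrow> mat3 \<Rightarrow> ereal" where
  "stored_energy C F e z = ereal (1/2 * ddot (C (e - z)) (e - z)) + F z"

definition dissipation_potential :: "(mat3 \<Rightarrow> real) \<Rightarrow> bool" where
  "dissipation_potential D \<longleftrightarrow>
     (\<forall>a\<in>Dev. D a \<ge> 0) \<and>
     (\<forall>a\<in>Dev. ereal (D a) \<le> Liminf (at a within Dev) (\<lambda>b. ereal (D b))) \<and>
     (\<forall>r>0. \<forall>a\<in>Dev. D (r *\<^sub>R a) = r * D a) \<and>
     (\<forall>b\<in>Dev. \<forall>c\<in>Dev. D (b + c) \<le> D b + D c) \<and>
     (\<exists>cD>0. \<forall>a\<in>Dev. D a \<ge> cD * norm a)"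

(* N = 0 is only possible for s = t and contributes the empty sum. *)
definition Diss :: "(mat3 \<Rightarrow> real) \<Rightarrow> (real \<Rightarrow> mat3) \<Rightarrow> real \<Rightarrow> real \<Rightarrow> ereal" where
  "Diss D z s t =
     (SUP (N, \<tau>) \<in> {(N :: nat, \<tau> :: nat \<Rightarrow> real).
                       \<tau> 0 = s \<and> \<tau> N = t \<and> (\<forall>i<N. \<tau> i < \<tau> (Suc i))}.
        ereal (\<Sum>i=1..N. D (z (\<tau> i) - z (\<tau> (i - 1)))))"

definition stable_states ::
    "(mat3 \<Rightarrow> mat3 \<Rightarrow> ereal) \<Rightarrow> (mat3 \<Rightarrow> real) \<Rightarrow> (real \<Rightarrow> mat3) \<Rightarrow> real \<Rightarrow> (mat3 \<times> mat3) set" where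
  "stable_states W D \<sigma> t =
     {(e, z). e \<in> Sym \<and> z \<in> Dev \<and>
        (\<forall>e'\<in>Sym. \<forall>z'\<in>Dev.
           W e z - ereal (ddot (\<sigma> t) e)
             \<le> W e' z' - ereal (ddot (\<sigma> t) e') + ereal (D (z' - z)))}"

(* Test functions are C^1 with compact support in the open interval (0,T), as in Brezis,
   Functional Analysis, Sobolev Spaces and PDE, Ch. 8. *)
definition weak_derivative ::
    "real \<Rightarrow> (real \<Rightarrow> 'a::euclidean_space) \<Rightarrow> (real \<Rightarrow> 'a) \<Rightarrow> bool" where
  "weak_derivative T u v \<longleftrightarrow>
     set_integrable lebesgue {0<..<T} u \<and> set_integrable lebesgue {0<..<T} v \<and>
     (\<forall>\<phi> :: real \<Rightarrow> real.
        \<phi> C1_differentiable_on UNIV \<and>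
        (\<exists>K. compact K \<and> K \<subseteq> {0<..<T} \<and> (\<forall>t. t \<notin> K \<longrightarrow> \<phi> t = 0)) \<longrightarrow>
        (LINT t:{0<..<T}|lebesgue. deriv \<phi> t *\<^sub>R u t)
          = - (LINT t:{0<..<T}|lebesgue. \<phi> t *\<^sub>R v t))"

(* W^{1,1}(0,T;X) for a closed subspace X; each class is identified with its continuous
   representative on [0,T], so that pointwise values such as u 0 make sense. The weak
   derivative is then X-valued almost everywhere. *)
definition W11 :: "real \<Rightarrow> 'a::euclidean_space set \<Rightarrow> (real \<Rightarrow> 'a) set" where
  "W11 T X = {u. continuous_on {0..T} u \<and> u ` {0..T} \<subseteq> X \<and> (\<exists>v. weak_derivative T u v)}"

(* \<sigma>' is an arbitrary version of the weak derivative of \<sigma>. *)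
definition energetic_solution ::
    "real \<Rightarrow> (mat3 \<Rightarrow> mat3 \<Rightarrow> ereal) \<Rightarrow> (mat3 \<Rightarrow> real) \<Rightarrow> (real \<Rightarrow> mat3) \<Rightarrow> (real \<Rightarrow> mat3)
       \<Rightarrow> (real \<Rightarrow> mat3) \<Rightarrow> (real \<Rightarrow> mat3) \<Rightarrow> bool" where
  "energetic_solution T W D \<sigma> \<sigma>' \<epsilon> z \<longleftrightarrow>
     set_integrable lebesgue {0..T} (\<lambda>t. ddot (\<sigma>' t) (\<epsilon> t)) \<and>
     (\<forall>t\<in>{0..T}.
        (\<epsilon> t, z t) \<in> stable_states W D \<sigma> t \<and>
        W (\<epsilon> t) (z t) - ereal (ddot (\<sigma> t) (\<epsilon> t)) + Diss D z 0 t
          = W (\<epsilon> 0) (z 0) - ereal (ddot (\<sigma> 0) (\<epsilon> 0))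
              - ereal (LINT s:{0..t}|lebesgue. ddot (\<sigma>' s) (\<epsilon> s)))"

end

(*
  The pair q = (\<epsilon>, z) solves a rate independent system whose stored energy is jointly strongly
  convex and whose load l = (\<sigma>, 0) is linear.  Strong convexity gives, for solutions of the
  incremental minimisation problems, the bound |q_k - q_j| <= (V_k - V_j) / \<alpha> with
  V(t) the integral of |\<sigma>'| over [0, t].  By Tychonoff's theorem the discrete solutions have
  a pointwise cluster point.  The discrete energy estimate and stability are pointwise conditions
  up to an error (V(t) - V(s))^2, so they pass to the limit, and because V is continuous such
  errors disappear when an interval is subdivided; this yields the energy balance without
  passing to the limit in the work integral.  Finally q is dominated by V, so the Radon-Nikodym
  theorem provides its density, that is, q is in W^{1,1}.
*)
theory Submission
  imports Defs
begin

section \<open>Errors quadratic in a continuous monotone function\<close>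

text \<open>Two features shape the argument. The load is only absolutely continuous, so
  \<open>V\<close> serves as the clock: time estimates are stated in its increments. And for \<rho>
  = 0 the hardening is infinite off a ball, so the evolution argument never differentiates the
  energy; both cases of \<rho> are cast as a continuous strongly convex function on a closed convex
  set \<open>K\<close>, with the constraint moved into \<open>K\<close>. The elastic term is
  degenerate along \<epsilon> = z, and joint convexity appears only together with the modulus
  \<open>c2\<close> of the hardening in z; the factor 1/3 in \<alpha> is the price of separating the
  two variables.

  The incremental energy estimate is proved with the work frozen at the earlier state. Freezing it
  at any state of the interval costs the same quadratic error, so the work integral can be put back
  after the limit, where it concerns a single continuous function. The same subdivision principle
  proves integration by parts, which together with a du Bois-Reymond argument turns the weak
  derivative of \<open>\<sigma>\<close> into increments.\<close>

lemma fine_partition: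
  fixes A :: "real \<Rightarrow> real"
  assumes "a \<le> b" and cont: "continuous_on {a..b} A" and mono: "mono_on {a..b} A" and "e > 0"
  obtains N :: nat and \<tau> :: "nat \<Rightarrow> real" where "\<tau> 0 = a" "\<tau> N = b"
    "\<And>i. i < N \<Longrightarrow> \<tau> i < \<tau> (Suc i)" "\<And>i. i \<le> N \<Longrightarrow> \<tau> i \<in> {a..b}"
    "(\<Sum>i<N. (A (\<tau> (Suc i)) - A (\<tau> i))\<^sup>2) \<le> e"
proof (cases "a = b")
  case True
  show ?thesis by (rule that[of "\<lambda>_. a" 0]) (use True \<open>e > 0\<close> in auto)
next
  case False
  then have ab: "a < b" using assms by simp
  have Aab: "A a \<le> A b" using mono ab by (auto simp: mono_on_def)
  \<comment> \<open>The sum of squares is at most the largest increment times the total increment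
    \<open>A b - A a\<close>, so increments below \<open>\<eta>\<close> suffice; the 1 keeps the
    denominator positive when \<open>A\<close> is constant.\<close>
  define \<eta> where "\<eta> = e / (1 + A b - A a)"
  have \<eta>: "\<eta> > 0" using Aab \<open>e > 0\<close> by (simp add: \<eta>_def)
  obtain d where d: "d > 0" "\<And>x y. x \<in> {a..b} \<Longrightarrow> y \<in> {a..b} \<Longrightarrow> dist x y < d \<Longrightarrow> dist (A x) (A y) < \<eta>"
    using compact_uniformly_continuous[OF cont] \<eta> unfolding uniformly_continuous_on_def
    by (metis compact_Icc)
  obtain N :: nat where N: "(b - a) / d < real N" using reals_Archimedean2 by blast
  have N0: "N > 0" using N ab d by (metis divide_pos_pos diff_gt_0_iff_gt gr0I less_asym of_nat_0)
  define \<tau> where "\<tau> i = a + real i * (b - a) / real N" for i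
  have in_ab: "\<tau> i \<in> {a..b}" if "i \<le> N" for i
  proof -
    have "real i * (b - a) \<le> real N * (b - a)" using that ab by (intro mult_right_mono) auto
    then have "real i * (b - a) / real N \<le> b - a" using N0 by (simp add: divide_le_eq mult.commute)
    moreover have "0 \<le> real i * (b - a) / real N" using ab by simp
    ultimately show ?thesis by (simp add: \<tau>_def)
  qed
  have step: "\<tau> (Suc i) - \<tau> i = (b - a) / real N" for i
    using N0 by (simp add: \<tau>_def field_simps)
  have lt: "\<tau> i < \<tau> (Suc i)" for i using step[of i] ab N0 by (smt (verit) divide_pos_pos of_nat_0_less_iff)
  have small: "(b - a) / real N < d" using N N0 d by (simp add: field_simps)
  have "(A (\<tau> (Suc i)) - A (\<tau> i))\<^sup>2 \<le> \<eta> * (A (\<tau> (Suc i)) - A (\<tau> i))" if "i < N" for i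
  proof -
    have "A (\<tau> i) \<le> A (\<tau> (Suc i))"
      using mono_onD[OF mono in_ab in_ab] lt[of i] that by simp
    moreover have "dist (A (\<tau> (Suc i))) (A (\<tau> i)) < \<eta>"
      using d(2)[OF in_ab in_ab, of "Suc i" i] step[of i] small lt[of i] that by (simp add: dist_real_def)
    ultimately show ?thesis
      by (simp add: dist_real_def power2_eq_square mult_right_mono)
  qed
  then have "(\<Sum>i<N. (A (\<tau> (Suc i)) - A (\<tau> i))\<^sup>2) \<le> (\<Sum>i<N. \<eta> * (A (\<tau> (Suc i)) - A (\<tau> i)))"
    by (intro sum_mono) auto
  also have "\<dots> = \<eta> * (A (\<tau> N) - A (\<tau> 0))"
    using sum_lessThan_telescope[of "\<lambda>i. A (\<tau> i)" N] by (simp flip: sum_distrib_left)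
  also have "\<dots> = \<eta> * (A b - A a)" using N0 by (simp add: \<tau>_def)
  also have "\<dots> \<le> \<eta> * (1 + A b - A a)" using \<eta> by simp
  also have "\<dots> = e" using Aab by (simp add: \<eta>_def)
  finally show ?thesis
    using N0 in_ab lt by (intro that[of \<tau> N]) (auto simp: \<tau>_def)
qed

lemma partition_subadditive:
  fixes d :: "real \<Rightarrow> real \<Rightarrow> real"
  assumes \<tau>: "\<And>i. i < N \<Longrightarrow> \<tau> i \<le> \<tau> (Suc i)" "\<And>i. i \<le> N \<Longrightarrow> \<tau> i \<in> S"
    and refl: "d (\<tau> 0) (\<tau> 0) \<le> 0"
    and tri: "\<And>s t u. s \<in> S \<Longrightarrow> t \<in> S \<Longrightarrow> u \<in> S \<Longrightarrow> s \<le> t \<Longrightarrow> t \<le> u \<Longrightarrow> d s u \<le> d s t + d t u"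
  shows "d (\<tau> 0) (\<tau> N) \<le> (\<Sum>i<N. d (\<tau> i) (\<tau> (Suc i)))"
proof -
  \<comment> \<open>The order \<open>\<tau> 0 \<le> \<tau> n\<close> is carried along because
    \<open>tri\<close> asks for ordered times; \<open>refl\<close> settles the empty sum.\<close>
  have "d (\<tau> 0) (\<tau> n) \<le> (\<Sum>i<n. d (\<tau> i) (\<tau> (Suc i))) \<and> \<tau> 0 \<le> \<tau> n" if "n \<le> N" for n
    using that
  proof (induction n)
    case 0
    then show ?case using refl by simp
  next
    case (Suc n)
    have "d (\<tau> 0) (\<tau> (Suc n)) \<le> d (\<tau> 0) (\<tau> n) + d (\<tau> n) (\<tau> (Suc n))"
      using Suc \<tau>(1)[of n] by (intro tri \<tau>(2)) auto
    then show ?case using Suc \<tau>(1)[of n] by simp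
  qed
  then show ?thesis by simp
qed

text \<open>This replaces "zero derivative implies constant" when time is measured by
  \<open>A\<close>: over a fine partition the quadratic errors sum to something arbitrarily small,
  while subadditivity keeps the left side at \<open>d a b\<close>.\<close>

lemma subadditive_quadratic_nonpos:
  fixes A :: "real \<Rightarrow> real" and d :: "real \<Rightarrow> real \<Rightarrow> real"
  assumes "a \<le> b" and cont: "continuous_on {a..b} A" and mono: "mono_on {a..b} A" and c: "c \<ge> 0"
    and tri: "\<And>s t u. a \<le> s \<Longrightarrow> s \<le> t \<Longrightarrow> t \<le> u \<Longrightarrow> u \<le> b \<Longrightarrow> d s u \<le> d s t + d t u"
    and quad: "\<And>s t. a \<le> s \<Longrightarrow> s \<le> t \<Longrightarrow> t \<le> b \<Longrightarrow> d s t \<le> c * (A t - A s)\<^sup>2"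
  shows "d a b \<le> 0"
proof (rule field_le_epsilon)
  fix e :: real assume e: "e > 0"
  \<comment> \<open>Dividing by \<open>c + 1\<close> instead of \<open>c\<close> covers
    \<open>c = 0\<close>.\<close>
  have pos: "e / (c + 1) > 0" using e c by simp
  obtain N :: nat and \<tau> where \<tau>: "\<tau> 0 = a" "\<tau> N = b"
    "\<And>i. i < N \<Longrightarrow> \<tau> i < \<tau> (Suc i)" "\<And>i. i \<le> N \<Longrightarrow> \<tau> i \<in> {a..b}"
    "(\<Sum>i<N. (A (\<tau> (Suc i)) - A (\<tau> i))\<^sup>2) \<le> e / (c + 1)"
    by (rule fine_partition[OF assms(1) cont mono pos]) blast
  have "d a b \<le> (\<Sum>i<N. d (\<tau> i) (\<tau> (Suc i)))"
    using partition_subadditive[of N \<tau> "{a..b}" d] \<tau>(1-4) tri quad[of a a] assms(1)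
    by (auto simp: less_imp_le)
  also have "\<dots> \<le> (\<Sum>i<N. c * (A (\<tau> (Suc i)) - A (\<tau> i))\<^sup>2)"
  proof (intro sum_mono quad)
    fix i assume "i \<in> {..<N}"
    then show "a \<le> \<tau> i" "\<tau> i \<le> \<tau> (Suc i)" "\<tau> (Suc i) \<le> b"
      using \<tau>(3)[of i] \<tau>(4)[of i] \<tau>(4)[of "Suc i"] by auto
  qed
  also have "\<dots> \<le> c * (e / (c + 1))"
    unfolding sum_distrib_left[symmetric] using \<tau>(5) c by (rule mult_left_mono)
  also have "\<dots> \<le> e" using c e by (simp add: field_simps)
  finally show "d a b \<le> 0 + e" by simp
qed

section \<open>Weak derivatives in one dimension\<close>

lemma absolutely_integrable_continuous_scaleR:
  fixes v :: "real \<Rightarrow> 'a::euclidean_space" and f :: "real \<Rightarrow> real"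
  assumes "continuous_on {a..b} f" "v absolutely_integrable_on {a..b}"
  shows "(\<lambda>x. f x *\<^sub>R v x) absolutely_integrable_on {a..b}"
  using assms
  by (intro absolutely_integrable_bounded_measurable_product[of "(*\<^sub>R)"])
     (auto simp: bilinear_def linear_iff scaleR_add_left scaleR_add_right
       intro: continuous_imp_measurable_on_sets_lebesgue compact_imp_bounded compact_continuous_image)

lemma absolutely_integrable_continuous_inner:
  fixes u v :: "real \<Rightarrow> 'a::euclidean_space"
  assumes "continuous_on {a..b} u" "v absolutely_integrable_on {a..b}"
  shows "(\<lambda>x. u x \<bullet> v x) absolutely_integrable_on {a..b}"
  using assms
  by (intro absolutely_integrable_bounded_measurable_product[of "(\<bullet>)"])
     (auto simp: bilinear_def linear_iff inner_add_left inner_add_right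
       intro: continuous_imp_measurable_on_sets_lebesgue compact_imp_bounded compact_continuous_image)

lemma integral_increment:
  fixes v :: "real \<Rightarrow> 'a::euclidean_space"
  assumes "v integrable_on {0..T}" "0 \<le> s" "s \<le> t" "t \<le> T"
  shows "integral {0..t} v - integral {0..s} v = integral {s..t} v"
proof -
  have "integral {0..s} v + integral {s..t} v = integral {0..t} v"
    by (rule Henstock_Kurzweil_Integration.integral_combine) (use assms in \<open>auto intro: integrable_on_subinterval\<close>)
  then show ?thesis by (simp add: algebra_simps)
qed

lemma C1_differentiable_real_D:
  fixes \<phi> :: "real \<Rightarrow> real"
  assumes "\<phi> C1_differentiable_on UNIV"
  shows "(\<phi> has_real_derivative deriv \<phi> x) (at x)" "continuous_on UNIV (deriv \<phi>)"
proof -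
  obtain D where D: "\<And>x. (\<phi> has_real_derivative D x) (at x)" "continuous_on UNIV D"
    using assms by (auto simp: C1_differentiable_on_def has_real_derivative_iff_has_vector_derivative)
  then have "deriv \<phi> = D" using DERIV_imp_deriv by blast
  with D show "(\<phi> has_real_derivative deriv \<phi> x) (at x)" "continuous_on UNIV (deriv \<phi>)" by auto
qed

text \<open>The end points are a null set, so the Lebesgue integrals over the open interval become
  Henstock-Kurzweil integrals over \<open>{0..T}\<close>, for which splitting of intervals and the
  fundamental theorem are at hand.\<close>

lemma weak_derivative_iff_Icc:
  fixes u v :: "real \<Rightarrow> 'a::euclidean_space"
  assumes "u absolutely_integrable_on {0..T}" "v absolutely_integrable_on {0..T}"
  shows "weak_derivative T u v \<longleftrightarrow>
     (\<forall>\<phi> :: real \<Rightarrow> real.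
        \<phi> C1_differentiable_on UNIV \<and>
        (\<exists>K. compact K \<and> K \<subseteq> {0<..<T} \<and> (\<forall>t. t \<notin> K \<longrightarrow> \<phi> t = 0)) \<longrightarrow>
        integral {0..T} (\<lambda>t. deriv \<phi> t *\<^sub>R u t) = - integral {0..T} (\<lambda>t. \<phi> t *\<^sub>R v t))"
proof -
  have *: "(LINT t:{0<..<T}|lebesgue. f t *\<^sub>R w t) = integral {0..T} (\<lambda>t. f t *\<^sub>R w t)"
    if "continuous_on UNIV f" "w absolutely_integrable_on {0..T}" for f :: "real \<Rightarrow> real" and w :: "real \<Rightarrow> 'a"
  proof -
    have "(\<lambda>t. f t *\<^sub>R w t) absolutely_integrable_on {0<..<T}"
      using absolutely_integrable_continuous_scaleR[OF continuous_on_subset[OF that(1) subset_UNIV] that(2)]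
      by (simp flip: absolutely_integrable_on_Icc_iff_Ioo)
    then show ?thesis
      using set_lebesgue_integral_eq_integral(2) by (metis integral_open_interval_real)
  qed
  have "continuous_on UNIV \<phi> \<and> continuous_on UNIV (deriv \<phi>)"
    if "\<phi> C1_differentiable_on UNIV" for \<phi> :: "real \<Rightarrow> real"
    using C1_differentiable_real_D[OF that] C1_differentiable_imp_continuous_on[OF that] by simp
  then show ?thesis
    unfolding weak_derivative_def using * assms
    by (auto simp flip: absolutely_integrable_on_Icc_iff_Ioo)
qed

text \<open>The defect in the integration by parts formula over \<open>[s, t]\<close> is quadratically small, hence zero.\<close>

lemma weak_derivative_indefinite_integral:
  fixes v :: "real \<Rightarrow> 'a::euclidean_space"
  assumes "T > 0" and v: "v absolutely_integrable_on {0..T}"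
    and u: "\<And>s t. 0 \<le> s \<Longrightarrow> s \<le> t \<Longrightarrow> t \<le> T \<Longrightarrow> u t - u s = integral {s..t} v"
  shows "weak_derivative T u v"
proof -
  have vi: "v integrable_on {0..T}" and nvi: "(\<lambda>r. norm (v r)) integrable_on {0..T}"
    using v by (auto simp: absolutely_integrable_on_def)
  have "continuous_on {0..T} (\<lambda>t. u 0 + integral {0..t} v)"
    by (intro continuous_intros indefinite_integral_continuous_1 vi)
  moreover have "u 0 + integral {0..t} v = u t" if "t \<in> {0..T}" for t
    using u[of 0 t] that by (simp add: algebra_simps)
  ultimately have ucont: "continuous_on {0..T} u" by (rule continuous_on_eq)
  define B where "B t = integral {0..t} (\<lambda>r. norm (v r))" for t
  \<comment> \<open>The defect will be bounded by the mixed product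
    \<open>(t - s) * (B t - B s)\<close>. Adding t to \<open>B\<close> makes twice this product part
    of the square of an increment of one monotone continuous function.\<close>
  define A where "A t = t + B t" for t
  have B: "B t - B s = integral {s..t} (\<lambda>r. norm (v r))" if "0 \<le> s" "s \<le> t" "t \<le> T" for s t
    unfolding B_def using integral_increment[OF nvi that] .
  have Bmono: "B s \<le> B t" if "0 \<le> s" "s \<le> t" "t \<le> T" for s t
  proof -
    have "0 \<le> integral {s..t} (\<lambda>r. norm (v r))"
      using integrable_on_subinterval[OF nvi, of s t] that by (intro integral_nonneg) auto
    then show ?thesis using B[OF that] by simp
  qed
  have uB: "norm (u t - u s) \<le> B t - B s" if "0 \<le> s" "s \<le> t" "t \<le> T" for s t
    unfolding B[OF that] u[OF that] using that
    by (intro Henstock_Kurzweil_Integration.integral_norm_bound_integral integrable_on_subinterval[OF vi] integrable_on_subinterval[OF nvi]) auto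
  have Acont: "continuous_on {0..T} A"
    unfolding A_def B_def by (intro continuous_intros indefinite_integral_continuous_1 nvi)
  have Amono: "mono_on {0..T} A" using Bmono by (auto simp: A_def mono_on_def intro: add_mono)
  have uint: "u absolutely_integrable_on {0..T}" by (rule absolutely_integrable_continuous_real[OF ucont])
  show ?thesis
    unfolding weak_derivative_iff_Icc[OF uint v]
  proof (intro allI impI, elim conjE exE)
    fix \<phi> :: "real \<Rightarrow> real" and K
    assume C1: "\<phi> C1_differentiable_on UNIV" and K: "compact K" "K \<subseteq> {0<..<T}" "\<forall>t. t \<notin> K \<longrightarrow> \<phi> t = 0"
    define g where "g = deriv \<phi>"
    have der: "(\<phi> has_real_derivative g x) (at x)" for x
      unfolding g_def by (rule C1_differentiable_real_D(1)[OF C1])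
    have gcont: "continuous_on UNIV g"
      unfolding g_def by (rule C1_differentiable_real_D(2)[OF C1])
    have \<phi>cont: "continuous_on UNIV \<phi>" using C1 C1_differentiable_imp_continuous_on by blast
    have \<phi>0: "\<phi> 0 = 0" "\<phi> T = 0" using K by auto
    have "compact (g ` {0..T})" using continuous_on_subset[OF gcont subset_UNIV] by (intro compact_continuous_image) auto
    then obtain L where L: "\<And>x. x \<in> {0..T} \<Longrightarrow> \<bar>g x\<bar> \<le> L"
      using compact_imp_bounded[of "g ` {0..T}"] unfolding bounded_iff by fastforce
    have L0: "L \<ge> 0" using L[of 0] \<open>T > 0\<close> by auto
    have \<phi>int: "integral {s..t} g = \<phi> t - \<phi> s" if "s \<le> t" for s t
      using fundamental_theorem_of_calculus[OF that, of \<phi> g] der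
      by (auto simp: has_real_derivative_iff_has_vector_derivative integral_unique
          intro: has_vector_derivative_at_within)
    have \<phi>lip: "\<bar>\<phi> t - \<phi> s\<bar> \<le> L * (t - s)" if "0 \<le> s" "s \<le> t" "t \<le> T" for s t
    proof -
      have "norm (integral {s..t} g) \<le> integral {s..t} (\<lambda>_. L)"
        using that L continuous_on_subset[OF gcont subset_UNIV]
        by (intro Henstock_Kurzweil_Integration.integral_norm_bound_integral integrable_continuous_real) auto
      then show ?thesis using that by (simp add: \<phi>int mult.commute)
    qed
    have gu: "(\<lambda>r. g r *\<^sub>R u r) integrable_on {0..T}" and \<phi>v: "(\<lambda>r. \<phi> r *\<^sub>R v r) integrable_on {0..T}"
      using absolutely_integrable_continuous_scaleR[OF continuous_on_subset[OF gcont subset_UNIV] uint]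
        absolutely_integrable_continuous_scaleR[OF continuous_on_subset[OF \<phi>cont subset_UNIV] v]
      by (auto simp: absolutely_integrable_on_def)
    \<comment> \<open>Its increment over \<open>[s, t]\<close> is the integration by parts defect
      there. Since \<open>\<phi>\<close> vanishes at 0 and T, \<open>G T = G 0\<close> is the weak
      formulation.\<close>
    define G where "G t = \<phi> t *\<^sub>R u t - integral {0..t} (\<lambda>r. g r *\<^sub>R u r) - integral {0..t} (\<lambda>r. \<phi> r *\<^sub>R v r)" for t
    have "norm (G t - G s) \<le> L * (A t - A s)\<^sup>2" if st: "0 \<le> s" "s \<le> t" "t \<le> T" for s t
    proof -
      have sub: "{s..t} \<subseteq> {0..T}" using st by auto
      have vst: "v integrable_on {s..t}" and nvst: "(\<lambda>r. norm (v r)) integrable_on {s..t}"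
        and gust: "(\<lambda>r. g r *\<^sub>R u r) integrable_on {s..t}" and \<phi>vst: "(\<lambda>r. \<phi> r *\<^sub>R v r) integrable_on {s..t}"
        using vi nvi gu \<phi>v sub integrable_on_subinterval by blast+
      have gst: "g integrable_on {s..t}" using continuous_on_subset[OF gcont subset_UNIV] by (intro integrable_continuous_real)
      \<comment> \<open>The boundary term is split as \<phi>(t) (u(t) - u(s)) + (\<phi>(t) -
        \<phi>(s)) u(s). In each of the two resulting integrals one factor vanishes at an end point,
        which supplies the second small factor of the bound.\<close>
      have 1: "integral {s..t} (\<lambda>r. (\<phi> t - \<phi> r) *\<^sub>R v r) = \<phi> t *\<^sub>R (u t - u s) - integral {s..t} (\<lambda>r. \<phi> r *\<^sub>R v r)"
        using integral_diff[OF integrable_cmul[OF vst, of "\<phi> t"] \<phi>vst] u[OF st] by (simp add: scaleR_diff_left)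
      have gus: "(\<lambda>r. g r *\<^sub>R u s) integrable_on {s..t}"
        using integrable_on_scaleR_left[OF gst] .
      have 2: "integral {s..t} (\<lambda>r. g r *\<^sub>R (u s - u r)) = (\<phi> t - \<phi> s) *\<^sub>R u s - integral {s..t} (\<lambda>r. g r *\<^sub>R u r)"
        using integral_diff[OF gus gust] has_integral_scaleR_left[OF integrable_integral[OF gst], of "u s"] \<phi>int[OF st(2)]
        by (simp add: scaleR_diff_right integral_unique)
      have "G t - G s = \<phi> t *\<^sub>R u t - \<phi> s *\<^sub>R u s - integral {s..t} (\<lambda>r. g r *\<^sub>R u r) - integral {s..t} (\<lambda>r. \<phi> r *\<^sub>R v r)"
        unfolding G_def using integral_increment[OF gu st] integral_increment[OF \<phi>v st] by (simp add: algebra_simps)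
      also have "\<dots> = integral {s..t} (\<lambda>r. (\<phi> t - \<phi> r) *\<^sub>R v r) + integral {s..t} (\<lambda>r. g r *\<^sub>R (u s - u r))"
        unfolding 1 2 by (simp add: algebra_simps)
      finally have "norm (G t - G s) \<le> norm (integral {s..t} (\<lambda>r. (\<phi> t - \<phi> r) *\<^sub>R v r))
          + norm (integral {s..t} (\<lambda>r. g r *\<^sub>R (u s - u r)))"
        by (simp add: norm_triangle_ineq)
      moreover have "norm (integral {s..t} (\<lambda>r. (\<phi> t - \<phi> r) *\<^sub>R v r)) \<le> integral {s..t} (\<lambda>r. (L * (t - s)) *\<^sub>R norm (v r))"
      proof (rule Henstock_Kurzweil_Integration.integral_norm_bound_integral)
        show "(\<lambda>r. (\<phi> t - \<phi> r) *\<^sub>R v r) integrable_on {s..t}"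
          using integrable_diff[OF integrable_cmul[OF vst, of "\<phi> t"] \<phi>vst] by (simp add: scaleR_diff_left)
        show "(\<lambda>r. (L * (t - s)) *\<^sub>R norm (v r)) integrable_on {s..t}" by (rule integrable_cmul[OF nvst])
        fix r assume r: "r \<in> {s..t}"
        have "\<bar>\<phi> t - \<phi> r\<bar> \<le> L * (t - r)" using r st by (intro \<phi>lip) auto
        also have "\<dots> \<le> L * (t - s)" using r L0 by (intro mult_left_mono) auto
        finally show "norm ((\<phi> t - \<phi> r) *\<^sub>R v r) \<le> (L * (t - s)) *\<^sub>R norm (v r)"
          by (simp add: mult_right_mono)
      qed
      moreover have "integral {s..t} (\<lambda>r. (L * (t - s)) *\<^sub>R norm (v r)) = L * (t - s) * (B t - B s)"
        unfolding B[OF st] by (subst integral_cmul) simp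
      moreover have "norm (integral {s..t} (\<lambda>r. g r *\<^sub>R (u s - u r))) \<le> integral {s..t} (\<lambda>r. L * (B t - B s))"
      proof (rule Henstock_Kurzweil_Integration.integral_norm_bound_integral)
        show "(\<lambda>r. g r *\<^sub>R (u s - u r)) integrable_on {s..t}"
          using integrable_diff[OF gus gust] by (simp add: scaleR_diff_right)
        fix r assume r: "r \<in> {s..t}"
        have "norm (u s - u r) \<le> B r - B s" using uB[of s r] r st by (simp add: norm_minus_commute)
        also have "\<dots> \<le> B t - B s" using Bmono[of r t] r st by simp
        finally have "\<bar>g r\<bar> * norm (u s - u r) \<le> L * (B t - B s)"
          using L[of r] r st L0 by (intro mult_mono) auto
        then show "norm (g r *\<^sub>R (u s - u r)) \<le> L * (B t - B s)" by simp
      qed auto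
      moreover have "integral {s..t} (\<lambda>r. L * (B t - B s)) = L * (t - s) * (B t - B s)"
        using st by simp
      ultimately have "norm (G t - G s) \<le> L * (2 * (t - s) * (B t - B s))" by (simp add: algebra_simps)
      also have "\<dots> \<le> L * (A t - A s)\<^sup>2"
      proof (rule mult_left_mono[OF _ L0])
        have "(A t - A s)\<^sup>2 - 2 * (t - s) * (B t - B s) = (t - s)\<^sup>2 + (B t - B s)\<^sup>2"
          by (simp add: A_def power2_eq_square algebra_simps)
        then show "2 * (t - s) * (B t - B s) \<le> (A t - A s)\<^sup>2"
          by (smt (verit) zero_le_power2)
      qed
      finally show ?thesis .
    qed
    moreover have "norm (G r - G s) \<le> norm (G t - G s) + norm (G r - G t)" for r s t
      using norm_triangle_ineq[of "G t - G s" "G r - G t"] by simp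
    ultimately have "norm (G T - G 0) \<le> 0"
      using subadditive_quadratic_nonpos[of 0 T A L "\<lambda>s t. norm (G t - G s)"] \<open>T > 0\<close> Acont Amono L0
      by auto
    then have "G T = G 0" by simp
    then have "integral {0..T} (\<lambda>t. g t *\<^sub>R u t) + integral {0..T} (\<lambda>t. \<phi> t *\<^sub>R v t) = 0"
      by (simp add: G_def \<phi>0) (metis add.right_inverse)
    then show "integral {0..T} (\<lambda>t. deriv \<phi> t *\<^sub>R u t) = - integral {0..T} (\<lambda>t. \<phi> t *\<^sub>R v t)"
      unfolding g_def by (simp add: eq_neg_iff_add_eq_0)
  qed
qed

text \<open>The test function is chosen so that its derivative is \<open>\<kappa> * (w - c)\<close>, with a tent
  \<open>\<kappa>\<close> on \<open>[a, b]\<close> and \<open>c\<close> the \<open>\<kappa>\<close>-mean of \<open>w\<close>; this forces \<open>\<integral>\<kappa> * (w - c)\<^sup>2 = 0\<close>.\<close>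

lemma du_Bois_Reymond_real:
  fixes w :: "real \<Rightarrow> real"
  assumes cont: "continuous_on {0..T} w" and ab: "0 < a" "a < b" "b < T"
    and zero: "\<And>\<phi>. \<phi> C1_differentiable_on UNIV \<Longrightarrow>
        (\<exists>K. compact K \<and> K \<subseteq> {0<..<T} \<and> (\<forall>t. t \<notin> K \<longrightarrow> \<phi> t = 0)) \<Longrightarrow>
        integral {0..T} (\<lambda>t. deriv \<phi> t * w t) = 0"
  shows "\<exists>c. \<forall>t\<in>{a<..<b}. w t = c"
proof -
  define \<kappa> :: "real \<Rightarrow> real" where "\<kappa> x = max 0 (min (x - a) (b - x))" for x
  have \<kappa>cont: "continuous_on S \<kappa>" for S unfolding \<kappa>_def by (intro continuous_intros)
  have \<kappa>0: "\<kappa> x \<ge> 0" for x by (simp add: \<kappa>_def)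
  have \<kappa>pos: "\<kappa> x > 0" if "x \<in> {a<..<b}" for x using that by (simp add: \<kappa>_def)
  have \<kappa>out: "\<kappa> x = 0" if "x \<notin> {a<..<b}" for x using that by (auto simp: \<kappa>_def)
  \<comment> \<open>Clamping the argument extends \<open>w\<close> continuously to the whole line,
    so that \<open>g\<close> has an antiderivative everywhere and \<open>\<phi>\<close> is C1 on
    \<open>UNIV\<close>.\<close>
  define w' where "w' x = w (max 0 (min T x))" for x
  have w'cont: "continuous_on S w'" for S
    unfolding w'_def
  proof (rule continuous_on_compose2[OF cont])
    show "continuous_on S (\<lambda>x. max 0 (min T x))" by (intro continuous_intros)
  qed (use ab in auto)
  have w': "w' x = w x" if "x \<in> {0..T}" for x using that by (simp add: w'_def)
  define c where "c = integral {a..b} (\<lambda>x. \<kappa> x * w' x) / integral {a..b} \<kappa>"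
  have "\<not> (\<forall>x\<in>{a..b}. \<kappa> x = 0)"
    using \<kappa>pos[of "(a + b) / 2"] ab by (auto intro!: bexI[of _ "(a + b) / 2"])
  then have "integral {a..b} \<kappa> \<noteq> 0"
    using integral_eq_0_iff[OF \<kappa>cont ab(2)] \<kappa>0 by metis
  then have c: "integral {a..b} (\<lambda>x. \<kappa> x * w' x) = c * integral {a..b} \<kappa>" by (simp add: c_def)
  define g where "g x = \<kappa> x * (w' x - c)" for x
  have gcont: "continuous_on S g" for S unfolding g_def by (intro continuous_intros \<kappa>cont w'cont)
  have gout: "g x = 0" if "x \<notin> {a<..<b}" for x using \<kappa>out[OF that] by (simp add: g_def)
  have gint: "integral {a..b} g = 0"
  proof -
    have "integral {a..b} g = integral {a..b} (\<lambda>x. \<kappa> x * w' x - c * \<kappa> x)"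
      by (simp add: g_def[abs_def] right_diff_distrib mult.commute)
    also have "\<dots> = integral {a..b} (\<lambda>x. \<kappa> x * w' x) - integral {a..b} (\<lambda>x. c * \<kappa> x)"
      by (intro integral_diff integrable_continuous_real continuous_intros \<kappa>cont w'cont)
    also have "\<dots> = 0" using c by simp
    finally show ?thesis .
  qed
  have "\<exists>F. \<forall>x :: real. - \<infinity> < ereal x \<longrightarrow> ereal x < \<infinity> \<longrightarrow> (F has_vector_derivative g x) (at x)"
    using gcont[of UNIV] by (intro einterval_antiderivative) (auto simp: continuous_on_eq_continuous_at)
  then obtain F where F: "\<And>x. (F has_vector_derivative g x) (at x)" by auto
  define \<phi> where "\<phi> x = F x - F a" for x
  have \<phi>der: "(\<phi> has_vector_derivative g x) (at x)" for x
    unfolding \<phi>_def using has_vector_derivative_diff[OF F has_vector_derivative_const] by simp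
  have \<phi>FTC: "integral {s..t} g = \<phi> t - \<phi> s" if "s \<le> t" for s t
    using fundamental_theorem_of_calculus[OF that, of \<phi> g] \<phi>der
    by (auto simp: integral_unique intro: has_vector_derivative_at_within)
  have \<phi>a: "\<phi> a = 0" by (simp add: \<phi>_def)
  have \<phi>b: "\<phi> b = 0" using \<phi>FTC[of a b] ab gint \<phi>a by simp
  \<comment> \<open>\<open>g\<close> vanishes outside \<open>[a, b]\<close> and has mean zero on it,
    so its antiderivative returns to 0 at b; this gives the compact support.\<close>
  have \<phi>out: "\<phi> x = 0" if "x \<notin> {a..b}" for x
  proof (cases "x < a")
    case True
    then have "integral {x..a} g = integral {x..a} (\<lambda>_. 0)" by (intro integral_cong gout) auto
    then show ?thesis using \<phi>FTC[of x a] True \<phi>a by simp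
  next
    case False
    then have "b < x" using that by auto
    then have "integral {b..x} g = integral {b..x} (\<lambda>_. 0)" by (intro integral_cong gout) auto
    then show ?thesis using \<phi>FTC[of b x] \<open>b < x\<close> \<phi>b by simp
  qed
  have C1: "\<phi> C1_differentiable_on UNIV"
    unfolding C1_differentiable_on_def using \<phi>der gcont by blast
  have deriv: "deriv \<phi> = g"
    using \<phi>der by (intro ext DERIV_imp_deriv) (simp add: has_real_derivative_iff_has_vector_derivative)
  have "\<exists>K. compact K \<and> K \<subseteq> {0<..<T} \<and> (\<forall>t. t \<notin> K \<longrightarrow> \<phi> t = 0)"
    using ab \<phi>out by (intro exI[of _ "{a..b}"]) auto
  from zero[OF C1 this] have "integral {0..T} (\<lambda>t. g t * w t) = 0" by (simp add: deriv)
  moreover have "integral {0..T} (\<lambda>t. g t * w t) = integral {0..T} (\<lambda>t. g t * w' t)"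
    by (intro integral_cong) (simp add: w')
  \<comment> \<open>Because \<open>g\<close> has mean zero, the constant \<open>c\<close> may be
    subtracted from \<open>w'\<close> in the tested integral, which turns the integrand into a
    nonnegative one.\<close>
  moreover have "integral {0..T} g = 0"
    using \<phi>FTC[of 0 T] \<phi>out[of 0] \<phi>out[of T] ab by simp
  moreover have "integral {0..T} (\<lambda>t. g t * w' t - c * g t)
      = integral {0..T} (\<lambda>t. g t * w' t) - integral {0..T} (\<lambda>t. c * g t)"
    by (intro integral_diff integrable_continuous_real continuous_intros gcont w'cont)
  ultimately have "integral {0..T} (\<lambda>t. g t * w' t - c * g t) = 0" by simp
  moreover have "(\<lambda>t. g t * w' t - c * g t) = (\<lambda>t. \<kappa> t * (w' t - c)\<^sup>2)"
    by (auto simp: g_def power2_eq_square algebra_simps)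
  ultimately have "integral {0..T} (\<lambda>t. \<kappa> t * (w' t - c)\<^sup>2) = 0" by simp
  moreover have "continuous_on {0..T} (\<lambda>t. \<kappa> t * (w' t - c)\<^sup>2)"
    by (intro continuous_intros \<kappa>cont w'cont)
  ultimately have eq: "\<forall>t\<in>{0..T}. \<kappa> t * (w' t - c)\<^sup>2 = 0"
    using integral_eq_0_iff[of 0 T "\<lambda>t. \<kappa> t * (w' t - c)\<^sup>2"] \<kappa>0 ab by auto
  have "w t = c" if "t \<in> {a<..<b}" for t
    using eq[rule_format, of t] \<kappa>pos[OF that] w'[of t] that ab by auto
  then show ?thesis by blast
qed

text \<open>The indefinite integral of \<open>v\<close> has the same weak derivative as
  \<open>u\<close>, so their difference has weak derivative zero. Its components are constant inside
  by \<open>du_Bois_Reymond_real\<close>, and continuity carries this to the end points.\<close>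

lemma weak_derivative_imp_integral:
  fixes u v :: "real \<Rightarrow> 'a::euclidean_space"
  assumes "T > 0" and wd: "weak_derivative T u v" and ucont: "continuous_on {0..T} u"
    and st: "0 \<le> s" "s \<le> t" "t \<le> T"
  shows "u t - u s = integral {s..t} v"
proof -
  have v: "v absolutely_integrable_on {0..T}"
    using wd by (simp add: weak_derivative_def absolutely_integrable_on_Icc_iff_Ioo)
  have vi: "v integrable_on {0..T}" using v by (auto simp: absolutely_integrable_on_def)
  have u: "u absolutely_integrable_on {0..T}" by (rule absolutely_integrable_continuous_real[OF ucont])
  define I where "I t = integral {0..t} v" for t
  have Icont: "continuous_on {0..T} I" unfolding I_def by (rule indefinite_integral_continuous_1[OF vi])
  have Iinc: "I t - I s = integral {s..t} v" if "0 \<le> s" "s \<le> t" "t \<le> T" for s t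
    unfolding I_def by (rule integral_increment[OF vi that])
  have I: "I absolutely_integrable_on {0..T}" by (rule absolutely_integrable_continuous_real[OF Icont])
  have wdI: "weak_derivative T I v"
    by (rule weak_derivative_indefinite_integral[OF \<open>T > 0\<close> v Iinc])
  define w where "w t = u t - I t" for t
  have wcont: "continuous_on {0..T} w" unfolding w_def by (intro continuous_intros ucont Icont)
  have w0: "integral {0..T} (\<lambda>t. deriv \<phi> t *\<^sub>R w t) = 0"
    if \<phi>: "\<phi> C1_differentiable_on UNIV" "\<exists>K. compact K \<and> K \<subseteq> {0<..<T} \<and> (\<forall>t. t \<notin> K \<longrightarrow> \<phi> t = 0)" for \<phi>
  proof -
    note dc = continuous_on_subset[OF C1_differentiable_real_D(2)[OF \<phi>(1)] subset_UNIV]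
    have "integral {0..T} (\<lambda>t. deriv \<phi> t *\<^sub>R w t)
       = integral {0..T} (\<lambda>t. deriv \<phi> t *\<^sub>R u t) - integral {0..T} (\<lambda>t. deriv \<phi> t *\<^sub>R I t)"
      unfolding w_def scaleR_diff_right
      by (intro integral_diff integrable_continuous_real continuous_intros dc ucont Icont)
    then show ?thesis
      using wd wdI \<phi> unfolding weak_derivative_iff_Icc[OF u v] weak_derivative_iff_Icc[OF I v] by simp
  qed
  have const: "w x \<bullet> e = w y \<bullet> e" if "x \<in> {0<..<T}" "y \<in> {0<..<T}" for x y e
  proof -
    \<comment> \<open>Halving the distances to 0 and T gives an interval that contains both x and y
      and stays strictly inside \<open>{0<..<T}\<close>.\<close>
    have "\<exists>c. \<forall>t\<in>{min x y / 2<..<(max x y + T) / 2}. w t \<bullet> e = c"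
    proof (rule du_Bois_Reymond_real)
      show "continuous_on {0..T} (\<lambda>t. w t \<bullet> e)" by (intro continuous_intros wcont)
      fix \<phi> :: "real \<Rightarrow> real"
      assume \<phi>: "\<phi> C1_differentiable_on UNIV" "\<exists>K. compact K \<and> K \<subseteq> {0<..<T} \<and> (\<forall>t. t \<notin> K \<longrightarrow> \<phi> t = 0)"
      note dc = continuous_on_subset[OF C1_differentiable_real_D(2)[OF \<phi>(1)] subset_UNIV]
      have "(\<lambda>t. deriv \<phi> t *\<^sub>R w t) integrable_on {0..T}"
        by (intro integrable_continuous_real continuous_intros dc wcont)
      from integral_linear[OF this bounded_linear_inner_left[of e]] w0[OF \<phi>]
      show "integral {0..T} (\<lambda>t. deriv \<phi> t * (w t \<bullet> e)) = 0" by (simp add: o_def)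
    qed (use that in auto)
    then obtain c where "\<forall>t\<in>{min x y / 2<..<(max x y + T) / 2}. w t \<bullet> e = c" by blast
    moreover have "x \<in> {min x y / 2<..<(max x y + T) / 2}" "y \<in> {min x y / 2<..<(max x y + T) / 2}"
      using that by (auto simp: min_def max_def)
    ultimately show ?thesis by metis
  qed
  have mid: "w x = w (T / 2)" if "x \<in> {0<..<T}" for x
    by (rule euclidean_eqI) (use that \<open>T > 0\<close> in \<open>auto intro!: const\<close>)
  have closure: "closure {0<..<T} = {0..T}" using \<open>T > 0\<close> by simp
  have "w x = w (T / 2)" if "x \<in> {0..T}" for x
    by (rule continuous_constant_on_closure[of "{0<..<T}" w, unfolded closure, OF wcont mid that])
  from this[of s] this[of t] have "w s = w t" using st by simp
  then show ?thesis using Iinc[OF st] by (simp add: w_def algebra_simps)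
qed

section \<open>Densities of dominated functions\<close>

text \<open>By domination both V + f and V - f are nondecreasing, V being the integral of
  \<open>w\<close>. Their Stieltjes measures add up to a measure with density 2w, hence each is
  absolutely continuous; the density of the first one minus \<open>w\<close> is the density sought
  for \<open>f\<close>.\<close>

lemma density_of_dominated_increments_real:
  fixes f w :: "real \<Rightarrow> real"
  assumes "T > 0" and wi: "w integrable_on {0..T}" and w0: "\<And>x. w x \<ge> 0"
    and fw: "\<And>s t. 0 \<le> s \<Longrightarrow> s \<le> t \<Longrightarrow> t \<le> T \<Longrightarrow> \<bar>f t - f s\<bar> \<le> integral {s..t} w"
  shows "\<exists>v. v absolutely_integrable_on {0..T} \<and>
    (\<forall>s t. 0 \<le> s \<longrightarrow> s \<le> t \<longrightarrow> t \<le> T \<longrightarrow> f t - f s = integral {s..t} v)"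
proof -
  define V where "V t = integral {0..t} w" for t
  have Vinc: "V t - V s = integral {s..t} w" if "0 \<le> s" "s \<le> t" "t \<le> T" for s t
    unfolding V_def by (rule integral_increment[OF wi that])
  have fV: "\<bar>f t - f s\<bar> \<le> V t - V s" if "0 \<le> s" "s \<le> t" "t \<le> T" for s t
    using fw[OF that] Vinc[OF that] by simp
  have Vcont: "continuous_on {0..T} V" unfolding V_def by (rule indefinite_integral_continuous_1[OF wi])
  have fcont: "continuous_on {0..T} f"
    unfolding continuous_on_iff
  proof (intro ballI allI impI)
    fix x e :: real assume x: "x \<in> {0..T}" and e: "0 < e"
    then obtain d where d: "d > 0" "\<And>y. y \<in> {0..T} \<Longrightarrow> dist y x < d \<Longrightarrow> dist (V y) (V x) < e"
      using Vcont unfolding continuous_on_iff by metis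
    have "dist (f y) (f x) < e" if y: "y \<in> {0..T}" "dist y x < d" for y
    proof -
      have "\<bar>f y - f x\<bar> \<le> \<bar>V y - V x\<bar>"
        using fV[of x y] fV[of y x] x y(1) by (cases "x \<le> y") auto
      then show ?thesis using d(2)[OF y] by (simp add: dist_real_def)
    qed
    then show "\<exists>d>0. \<forall>x'\<in>{0..T}. dist x' x < d \<longrightarrow> dist (f x') (f x) < e" using d(1) by blast
  qed
  \<comment> \<open>\<open>interval_measure\<close> takes a function on the whole line; clamping
    extends \<open>F1\<close> and \<open>F2\<close> by constants, which adds no mass outside
    \<open>[0, T]\<close>.\<close>
  define cl where "cl x = max 0 (min T x)" for x
  have cl: "cl x \<in> {0..T}" for x using \<open>T > 0\<close> by (auto simp: cl_def)
  have cl_mono: "cl x \<le> cl y" if "x \<le> y" for x y using that by (auto simp: cl_def)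
  have cl_id: "cl x = x" if "x \<in> {0..T}" for x using that by (auto simp: cl_def)
  have clcont: "continuous_on UNIV cl" unfolding cl_def by (intro continuous_intros)
  define F1 where "F1 x = V (cl x) + f (cl x)" for x
  define F2 where "F2 x = V (cl x) - f (cl x)" for x
  have F1_mono: "F1 x \<le> F1 y" and F2_mono: "F2 x \<le> F2 y" if "x \<le> y" for x y
    using fV[of "cl x" "cl y"] cl_mono[OF that] cl[of x] cl[of y] by (auto simp: F1_def F2_def)
  have "continuous_on UNIV F1" "continuous_on UNIV F2" unfolding F1_def F2_def
    by (intro continuous_intros continuous_on_compose2[OF Vcont clcont] continuous_on_compose2[OF fcont clcont]; use cl in auto)+
  then have F1_right: "continuous (at_right x) F1" and F2_right: "continuous (at_right x) F2" for x
    by (auto simp: continuous_on_eq_continuous_at continuous_at_imp_continuous_within)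
  define M1 where "M1 = interval_measure F1"
  define M2 where "M2 = interval_measure F2"
  have M1_Ioc: "emeasure M1 {a<..b} = F1 b - F1 a" and M2_Ioc: "emeasure M2 {a<..b} = F2 b - F2 a" if "a \<le> b" for a b
    unfolding M1_def M2_def using that F1_mono F1_right F2_mono F2_right
    by (auto intro!: emeasure_interval_measure_Ioc)
  \<comment> \<open>In the sum of the two measures \<open>f\<close> cancels, so its mass on
    half-open intervals depends on \<open>V\<close> alone.\<close>
  define M where "M = measure_of UNIV (sets borel) (\<lambda>A. emeasure M1 A + emeasure M2 A)"
  have sets_M: "sets M = sets borel" unfolding M_def
    using sets.sigma_sets_eq[of "borel :: real measure"] by (simp add: sets_measure_of_conv)
  have M: "emeasure M A = emeasure M1 A + emeasure M2 A" if "A \<in> sets borel" for A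
  proof (rule emeasure_measure_of[OF M_def])
    show "countably_additive (sets M) (\<lambda>A. emeasure M1 A + emeasure M2 A)"
      unfolding sets_M countably_additive_def
    proof (intro allI impI)
      fix A :: "nat \<Rightarrow> real set" assume A: "range A \<subseteq> sets borel" "disjoint_family A"
      have "(\<Sum>i. emeasure M1 (A i) + emeasure M2 (A i)) = (\<Sum>i. emeasure M1 (A i)) + (\<Sum>i. emeasure M2 (A i))"
        by (intro suminf_add[symmetric]) auto
      then show "(\<Sum>i. emeasure M1 (A i) + emeasure M2 (A i)) = emeasure M1 (\<Union> (range A)) + emeasure M2 (\<Union> (range A))"
        using suminf_emeasure[of A M1] suminf_emeasure[of A M2] A by (simp add: M1_def M2_def)
    qed
  qed (use that sets_M in \<open>auto simp: positive_def\<close>)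
  define g where "g x = ennreal (indicator {0..T} x * (2 * w x))" for x
  have "(\<lambda>x. indicator {0..T} x *\<^sub>R w x) \<in> borel_measurable lebesgue"
    using has_integral_implies_lebesgue_measurable[OF integrable_integral[OF wi]] .
  then have "(\<lambda>x. 2 * (indicator {0..T} x *\<^sub>R w x)) \<in> borel_measurable lebesgue" by measurable
  then have g: "g \<in> borel_measurable lebesgue" unfolding g_def by (simp add: mult.left_commute)
  \<comment> \<open>\<open>w\<close> is only known to be Lebesgue measurable, so the density is
    taken over \<open>lebesgue\<close>; pushing forward along the identity restricts the result to
    Borel sets, where it can be compared with \<open>M\<close>.\<close>
  define M' where "M' = distr (density lebesgue g) borel (\<lambda>x. x)"
  have id: "(\<lambda>x. x) \<in> measurable (density lebesgue g) borel"
    by (simp add: measurable_completion)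
  have M': "emeasure M' A = (\<integral>\<^sup>+x. g x * indicator A x \<partial>lebesgue)" if "A \<in> sets borel" for A
    unfolding M'_def using that g id by (subst emeasure_distr) (auto simp: emeasure_density)
  have M'_Ioc: "emeasure M' {a<..b} = 2 * (V (cl b) - V (cl a))" if "a \<le> b" for a b
  proof -
    \<comment> \<open>Within \<open>[0, T]\<close> the sets \<open>{a<..b}\<close> and
      \<open>{cl a..cl b}\<close> differ at most in the point \<open>cl a\<close>.\<close>
    have "AE x in lborel. x \<noteq> cl a" by (rule AE_lborel_singleton)
    then have "(\<integral>\<^sup>+x. g x * indicator {a<..b} x \<partial>lborel)
      = (\<integral>\<^sup>+x. ennreal (indicator {cl a..cl b} x * (2 * w x)) \<partial>lborel)"
    proof (intro nn_integral_cong_AE, eventually_elim)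
      case (elim x)
      then show ?case using \<open>T > 0\<close>
        by (auto simp: g_def cl_def indicator_def max_def min_def split: if_splits)
    qed
    also have "\<dots> = integral {cl a..cl b} (\<lambda>x. 2 * w x)"
    proof (intro nn_integral_has_integral_lebesgue integrable_integral)
      show "(\<lambda>x. 2 * w x) integrable_on {cl a..cl b}"
        using integrable_on_subinterval[OF wi, of "cl a" "cl b"] cl[of a] cl[of b]
        by (intro integrable_on_mult_right) auto
    qed (use w0 in auto)
    also have "integral {cl a..cl b} (\<lambda>x. 2 * w x) = 2 * (V (cl b) - V (cl a))"
      using Vinc[of "cl a" "cl b"] cl_mono[OF that] cl[of a] cl[of b] by simp
    finally show ?thesis using M'[of "{a<..b}"] by (simp add: nn_integral_completion)
  qed
  have "M = M'"
  proof (rule measure_eqI_generator_eq)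
    let ?E = "range (\<lambda>(a, b). {a<..b::real})"
    show "Int_stable ?E" by (auto simp: Int_stable_def)
    show "?E \<subseteq> Pow UNIV" by simp
    show Ioc: "emeasure M X = emeasure M' X" if "X \<in> ?E" for X
    proof -
      from that obtain p where "X = (case p of (a, b) \<Rightarrow> {a<..b})" by blast
      then obtain a b where X: "X = {a<..b}" by (cases p) auto
      show ?thesis
      proof (cases "a \<le> b")
        case True
        then show ?thesis unfolding X
          using M1_Ioc[OF True] M2_Ioc[OF True] F1_mono[OF True] F2_mono[OF True]
          by (subst M'_Ioc) (auto simp: M F1_def F2_def simp flip: ennreal_plus)
      qed (simp add: X)
    qed
    show "sets M = sigma_sets UNIV ?E" "sets M' = sigma_sets UNIV ?E"
      unfolding sets_M by (simp_all add: M'_def borel_sigma_sets_Ioc)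
    show "range (\<lambda>n::nat. {- real n<..real n}) \<subseteq> ?E" by auto
    show "(\<Union>n::nat. {- real n<..real n}) = UNIV"
    proof (intro equalityI subsetI UNIV_I)
      fix x :: real
      obtain n :: nat where "\<bar>x\<bar> < real n" using reals_Archimedean2 by blast
      then show "x \<in> (\<Union>n::nat. {- real n<..real n})" by (intro UN_I[of n]) auto
    qed
    show "emeasure M {- real n<..real n} \<noteq> \<infinity>" for n
      by (simp add: M M1_Ioc M2_Ioc)
  qed
  \<comment> \<open>\<open>M1\<close> is one summand of \<open>M = M'\<close>, and \<open>M'\<close>
    vanishes on null sets because it has a density.\<close>
  have "absolutely_continuous lborel M1"
    unfolding absolutely_continuous_def
  proof
    fix A :: "real set" assume A: "A \<in> null_sets lborel"
    then have Ab: "A \<in> sets borel" by auto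
    have "A \<in> null_sets lebesgue" using A null_sets_completionI by blast
    then have "emeasure (density lebesgue g) A = 0"
      using absolutely_continuousI_density[OF g] unfolding absolutely_continuous_def by blast
    then have "emeasure M' A = 0"
      unfolding M'_def using Ab id by (simp add: emeasure_distr)
    then have "emeasure M1 A = 0" using M[OF Ab] \<open>M = M'\<close> by simp
    then show "A \<in> null_sets M1" using Ab by (simp add: null_sets_def M1_def)
  qed
  moreover have "sets M1 = sets lborel" by (simp add: M1_def)
  ultimately obtain h where h: "h \<in> borel_measurable lborel" and hM: "density lborel h = M1"
    using sigma_finite_measure.Radon_Nikodym[OF sigma_finite_lborel] by blast
  have hM_Ioc: "(\<integral>\<^sup>+x. h x * indicator {a<..b} x \<partial>lborel) = F1 b - F1 a" if "a \<le> b" for a b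
    using M1_Ioc[OF that] h emeasure_density[OF h, of "{a<..b}"] by (simp add: hM)
  have "AE x in lborel. h x * indicator {0<..T} x \<noteq> \<infinity>"
    using hM_Ioc[of 0 T] \<open>T > 0\<close> h by (intro nn_integral_PInf_AE) auto
  then have fin: "AE x in lborel. x \<in> {0<..T} \<longrightarrow> h x \<noteq> \<infinity>"
    by eventually_elim (auto simp: indicator_def)
  \<comment> \<open>\<open>enn2real\<close> sends infinity to 0; this changes nothing under the
    integral, since by \<open>fin\<close> the density is finite almost everywhere on
    \<open>{0<..T}\<close>.\<close>
  define v where "v x = enn2real (h x)" for x
  have v_has: "(v has_integral (F1 t - F1 s)) {s..t}" if st: "0 \<le> s" "s \<le> t" "t \<le> T" for s t
  proof -
    have "(\<integral>\<^sup>+x. ennreal (indicator {s<..t} x * v x) \<partial>lborel) = (\<integral>\<^sup>+x. h x * indicator {s<..t} x \<partial>lborel)"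
    proof (intro nn_integral_cong_AE)
      show "AE x in lborel. ennreal (indicator {s<..t} x * v x) = h x * indicator {s<..t} x"
        using fin by eventually_elim (use st in \<open>auto simp: v_def indicator_def less_top[symmetric]\<close>)
    qed
    moreover have "(\<lambda>x. indicator {s<..t} x * v x) \<in> borel_measurable borel"
      unfolding v_def using h by measurable
    ultimately have "((\<lambda>x. indicator {s<..t} x * v x) has_integral (F1 t - F1 s)) UNIV"
      using hM_Ioc[OF st(2)] F1_mono[OF st(2)]
      by (intro nn_integral_has_integral) (auto simp: v_def)
    moreover have "(\<lambda>x. indicator {s<..t} x * v x) = (\<lambda>x. if x \<in> {s<..t} then v x else 0)"
      by (auto simp: indicator_def)
    ultimately have "(v has_integral (F1 t - F1 s)) {s<..t}"
      by (simp only: has_integral_restrict_UNIV)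
    moreover have "negligible {x \<in> {s<..t} - {s..t}. v x \<noteq> 0}"
      by (rule negligible_subset[of "{}"]) auto
    moreover have "negligible {x \<in> {s..t} - {s<..t}. v x \<noteq> 0}"
      by (rule negligible_subset[of "{s}"]) auto
    ultimately show ?thesis
      using has_integral_spike_set_eq[of "{s<..t}" "{s..t}" v "F1 t - F1 s"] by blast
  qed
  have vi: "v integrable_on {0..T}" using v_has[of 0 T] \<open>T > 0\<close> by auto
  have "v absolutely_integrable_on {0..T}"
    by (rule nonnegative_absolutely_integrable_1[OF vi]) (simp add: v_def)
  moreover have "w absolutely_integrable_on {0..T}"
    by (rule nonnegative_absolutely_integrable_1[OF wi]) (simp add: w0)
  ultimately have "(\<lambda>x. v x - w x) absolutely_integrable_on {0..T}" by (rule set_integral_diff(1))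
  moreover have "f t - f s = integral {s..t} (\<lambda>x. v x - w x)" if st: "0 \<le> s" "s \<le> t" "t \<le> T" for s t
  proof -
    have "integral {s..t} (\<lambda>x. v x - w x) = integral {s..t} v - integral {s..t} w"
      by (intro integral_diff integrable_on_subinterval[OF vi] integrable_on_subinterval[OF wi]) (use st in auto)
    also have "\<dots> = (F1 t - F1 s) - (V t - V s)"
      using v_has[OF st] Vinc[OF st] by (simp add: integral_unique)
    finally show ?thesis using st by (simp add: F1_def cl_id)
  qed
  ultimately show ?thesis by blast
qed

lemma density_of_dominated_increments:
  fixes f :: "real \<Rightarrow> 'a::euclidean_space" and w :: "real \<Rightarrow> real"
  assumes "T > 0" and wi: "w integrable_on {0..T}" and w0: "\<And>x. w x \<ge> 0"
    and fw: "\<And>s t. 0 \<le> s \<Longrightarrow> s \<le> t \<Longrightarrow> t \<le> T \<Longrightarrow> norm (f t - f s) \<le> integral {s..t} w"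
  shows "\<exists>v. v absolutely_integrable_on {0..T} \<and>
    (\<forall>s t. 0 \<le> s \<longrightarrow> s \<le> t \<longrightarrow> t \<le> T \<longrightarrow> f t - f s = integral {s..t} v)"
proof -
  have "\<exists>v. v absolutely_integrable_on {0..T} \<and>
    (\<forall>s t. 0 \<le> s \<longrightarrow> s \<le> t \<longrightarrow> t \<le> T \<longrightarrow> f t \<bullet> b - f s \<bullet> b = integral {s..t} v)" if "b \<in> Basis" for b
  proof (rule density_of_dominated_increments_real[OF \<open>T > 0\<close> wi w0])
    fix s t :: real assume "0 \<le> s" "s \<le> t" "t \<le> T"
    then show "\<bar>f t \<bullet> b - f s \<bullet> b\<bar> \<le> integral {s..t} w"
      using fw[of s t] Basis_le_norm[OF that, of "f t - f s"] by (simp add: inner_diff_left)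
  qed
  then obtain v where v: "\<And>b. b \<in> Basis \<Longrightarrow> v b absolutely_integrable_on {0..T}"
    "\<And>b s t. b \<in> Basis \<Longrightarrow> 0 \<le> s \<Longrightarrow> s \<le> t \<Longrightarrow> t \<le> T \<Longrightarrow> f t \<bullet> b - f s \<bullet> b = integral {s..t} (v b)"
    by metis
  define u where "u x = (\<Sum>b\<in>Basis. v b x *\<^sub>R b)" for x
  have u: "u absolutely_integrable_on {0..T}"
    unfolding u_def by (intro absolutely_integrable_sum absolutely_integrable_scaleR_right v) auto
  have "f t - f s = integral {s..t} u" if st: "0 \<le> s" "s \<le> t" "t \<le> T" for s t
  proof (rule euclidean_eqI)
    fix b :: 'a assume b: "b \<in> Basis"
    have "u integrable_on {s..t}"
      using u st by (auto simp: absolutely_integrable_on_def intro: integrable_on_subinterval)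
    from integral_linear[OF this bounded_linear_inner_left[of b]]
    have "integral {s..t} u \<bullet> b = integral {s..t} (\<lambda>x. u x \<bullet> b)" by (simp add: o_def)
    also have "(\<lambda>x. u x \<bullet> b) = v b" using b by (simp add: u_def fun_eq_iff)
    finally show "(f t - f s) \<bullet> b = integral {s..t} u \<bullet> b"
      using v(2)[OF b st] by (simp add: inner_diff_left)
  qed
  then show ?thesis using u by blast
qed

section \<open>Strong convexity\<close>

text \<open>Normalised so that \<alpha> is a lower bound for the Hessian: half of \<alpha> times the
  squared norm attains it with equality.\<close>

definition strongly_convex_on :: "'a::real_inner set \<Rightarrow> real \<Rightarrow> ('a \<Rightarrow> real) \<Rightarrow> bool" where
  "strongly_convex_on K \<alpha> f \<longleftrightarrow> (\<forall>x\<in>K. \<forall>y\<in>K. \<forall>\<theta>\<in>{0..1}.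
     f ((1 - \<theta>) *\<^sub>R x + \<theta> *\<^sub>R y) \<le> (1 - \<theta>) * f x + \<theta> * f y - \<alpha> / 2 * \<theta> * (1 - \<theta>) * (norm (x - y))\<^sup>2)"

lemma strongly_convex_onD:
  assumes "strongly_convex_on K \<alpha> f" "x \<in> K" "y \<in> K" "0 \<le> \<theta>" "\<theta> \<le> 1"
  shows "f ((1 - \<theta>) *\<^sub>R x + \<theta> *\<^sub>R y)
    \<le> (1 - \<theta>) * f x + \<theta> * f y - \<alpha> / 2 * \<theta> * (1 - \<theta>) * (norm (x - y))\<^sup>2"
  using assms by (auto simp: strongly_convex_on_def)

lemma strongly_convex_on_add_convex:
  assumes f: "strongly_convex_on K \<alpha> f" and g: "convex_on K g"
  shows "strongly_convex_on K \<alpha> (\<lambda>x. f x + g x)"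
  unfolding strongly_convex_on_def
proof (intro ballI)
  fix x y and \<theta> :: real assume *: "x \<in> K" "y \<in> K" "\<theta> \<in> {0..1}"
  have "g ((1 - \<theta>) *\<^sub>R x + \<theta> *\<^sub>R y) \<le> (1 - \<theta>) * g x + \<theta> * g y"
    using convex_onD[OF g] * by auto
  then show "f ((1 - \<theta>) *\<^sub>R x + \<theta> *\<^sub>R y) + g ((1 - \<theta>) *\<^sub>R x + \<theta> *\<^sub>R y)
    \<le> (1 - \<theta>) * (f x + g x) + \<theta> * (f y + g y) - \<alpha> / 2 * \<theta> * (1 - \<theta>) * (norm (x - y))\<^sup>2"
    using strongly_convex_onD[OF f, of x y \<theta>] * by (auto simp: algebra_simps)
qed

text \<open>Minimality is compared with the point a fraction \<theta> of the way to
  \<open>y\<close>; division by \<theta> and \<theta> tending to 0 leave the full quadratic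
  term.\<close>

lemma strongly_convex_on_minimizer_gap:
  assumes f: "strongly_convex_on K \<alpha> f" and K: "convex K" and x: "x \<in> K"
    and min: "\<And>y. y \<in> K \<Longrightarrow> f x \<le> f y" and y: "y \<in> K"
  shows "f x + \<alpha> / 2 * (norm (y - x))\<^sup>2 \<le> f y"
proof -
  have *: "f x + \<alpha> / 2 * (1 - \<theta>) * (norm (y - x))\<^sup>2 \<le> f y" if \<theta>: "0 < \<theta>" "\<theta> < 1" for \<theta>
  proof -
    have "(1 - \<theta>) *\<^sub>R x + \<theta> *\<^sub>R y \<in> K"
      using convexD_alt[OF K x y] \<theta> by auto
    then have "f x \<le> (1 - \<theta>) * f x + \<theta> * f y - \<alpha> / 2 * \<theta> * (1 - \<theta>) * (norm (y - x))\<^sup>2"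
      using strongly_convex_onD[OF f x y, of \<theta>] min \<theta> by (fastforce simp: norm_minus_commute)
    then have "\<theta> * (f x + \<alpha> / 2 * (1 - \<theta>) * (norm (y - x))\<^sup>2) \<le> \<theta> * f y"
      by (simp add: algebra_simps)
    then show ?thesis using \<theta> by simp
  qed
  have "((\<lambda>\<theta>. f x + \<alpha> / 2 * (1 - \<theta>) * (norm (y - x))\<^sup>2) \<longlongrightarrow> f x + \<alpha> / 2 * (1 - 0) * (norm (y - x))\<^sup>2) (at_right 0)"
    by (intro tendsto_intros)
  moreover have "eventually (\<lambda>\<theta>. f x + \<alpha> / 2 * (1 - \<theta>) * (norm (y - x))\<^sup>2 \<le> f y) (at_right 0)"
    unfolding eventually_at_right_field using * by (intro exI[of _ 1]) auto
  ultimately show ?thesis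
    using tendsto_upperbound[of _ _ "at_right (0::real)"] by fastforce
qed

text \<open>No lower bound on \<open>f\<close> is assumed. The minimum over the unit ball around
  \<open>p\<close> bounds how fast \<open>f\<close> can fall along a ray from \<open>p\<close>, and
  the quadratic term then pushes \<open>f\<close> above \<open>f p\<close> beyond a radius, so a
  compact part of \<open>K\<close> suffices.\<close>

lemma strongly_convex_on_attains_min:
  fixes K :: "'a::euclidean_space set"
  assumes f: "strongly_convex_on K \<alpha> f" and "\<alpha> > 0" and K: "convex K" "closed K" "K \<noteq> {}"
    and cont: "continuous_on K f"
  shows "\<exists>x\<in>K. \<forall>y\<in>K. f x \<le> f y"
proof -
  obtain p where p: "p \<in> K" using K by auto
  have "compact (K \<inter> cball p 1)" using K by (simp add: closed_Int_compact)
  moreover have "continuous_on (K \<inter> cball p 1) f" using cont continuous_on_subset by blast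
  moreover have "K \<inter> cball p 1 \<noteq> {}" using p by auto
  ultimately obtain m where m: "m \<in> K \<inter> cball p 1" "\<And>y. y \<in> K \<inter> cball p 1 \<Longrightarrow> f m \<le> f y"
    using continuous_attains_inf by metis
  have mp: "f m \<le> f p" using m(2) p by simp
  \<comment> \<open>Chosen so that n > r gives \<alpha>/2 (n - 1) \<ge> f(p) - f(m); the summand 2
    also ensures n > 1.\<close>
  define r where "r = 2 + 2 * (f p - f m) / \<alpha>"
  have r: "r \<ge> 2" using mp \<open>\<alpha> > 0\<close> by (simp add: r_def)
  have far: "f p \<le> f y" if y: "y \<in> K" and n: "norm (y - p) > r" for y
  proof -
    define n where "n = norm (y - p)"
    have n1: "n > 1" "n > r" using n r by (auto simp: n_def)
    \<comment> \<open>The point of the segment from \<open>p\<close> to \<open>y\<close> at distance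
      1 from \<open>p\<close>, where the bound by \<open>f m\<close> is available.\<close>
    define x where "x = (1 - 1/n) *\<^sub>R p + (1/n) *\<^sub>R y"
    have "x \<in> K" unfolding x_def using convexD_alt[OF K(1) p y] n1 by auto
    moreover have "x - p = (1/n) *\<^sub>R (y - p)" by (simp add: x_def algebra_simps)
    then have "norm (x - p) = 1" using n1 by (simp add: n_def[symmetric])
    ultimately have "f m \<le> f x" using m(2) by (simp add: dist_norm norm_minus_commute)
    also have "\<dots> \<le> (1 - 1/n) * f p + 1/n * f y - \<alpha> / 2 * (1/n) * (1 - 1/n) * n\<^sup>2"
      using strongly_convex_onD[OF f p y, of "1/n"] n1 by (simp add: x_def n_def[symmetric] norm_minus_commute[of p y])
    finally have "n * f m \<le> n * ((1 - 1/n) * f p + 1/n * f y - \<alpha> / 2 * (1/n) * (1 - 1/n) * n\<^sup>2)"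
      using n1 by simp
    also have "\<dots> = (n - 1) * f p + f y - \<alpha> / 2 * (n - 1) * n"
      using n1 by (simp add: field_simps power2_eq_square)
    finally have "f y \<ge> f p + n * (\<alpha> / 2 * (n - 1) - (f p - f m))"
      by (simp add: algebra_simps)
    moreover have "\<alpha> / 2 * (n - 1) \<ge> f p - f m"
    proof -
      have "2 * (f p - f m) / \<alpha> \<le> n - 1" using n1 r_def by simp
      then show ?thesis using \<open>\<alpha> > 0\<close> by (simp add: field_simps)
    qed
    then have "n * (\<alpha> / 2 * (n - 1) - (f p - f m)) \<ge> 0" using n1 by auto
    ultimately show ?thesis by simp
  qed
  have "compact (K \<inter> cball p r)" using K by (simp add: closed_Int_compact)
  moreover have "continuous_on (K \<inter> cball p r) f" using cont continuous_on_subset by blast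
  moreover have "K \<inter> cball p r \<noteq> {}" using p r by auto
  ultimately obtain x where x: "x \<in> K \<inter> cball p r" "\<And>y. y \<in> K \<inter> cball p r \<Longrightarrow> f x \<le> f y"
    using continuous_attains_inf by metis
  have "f x \<le> f y" if "y \<in> K" for y
  proof (cases "norm (y - p) > r")
    case True
    have "f x \<le> f p" using x(2) p r by simp
    then show ?thesis using far[OF that True] by simp
  next
    case False
    then show ?thesis using x(2) that by (simp add: dist_norm norm_minus_commute)
  qed
  then show ?thesis using x by auto
qed

lemma strongly_convex_on_mono:
  assumes "strongly_convex_on K \<beta> f" "\<alpha> \<le> \<beta>"
  shows "strongly_convex_on K \<alpha> f"
  unfolding strongly_convex_on_def
proof (intro ballI)
  fix x y and \<theta> :: real assume *: "x \<in> K" "y \<in> K" "\<theta> \<in> {0..1}"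
  have "\<alpha> / 2 * \<theta> * (1 - \<theta>) * (norm (x - y))\<^sup>2 \<le> \<beta> / 2 * \<theta> * (1 - \<theta>) * (norm (x - y))\<^sup>2"
    using * assms(2) by (intro mult_right_mono) auto
  then show "f ((1 - \<theta>) *\<^sub>R x + \<theta> *\<^sub>R y) \<le> (1 - \<theta>) * f x + \<theta> * f y - \<alpha> / 2 * \<theta> * (1 - \<theta>) * (norm (x - y))\<^sup>2"
    using strongly_convex_onD[OF assms(1), of x y \<theta>] * by auto
qed

lemma norm_convex_combination:
  fixes x y :: "'a::real_inner"
  shows "(norm ((1 - \<theta>) *\<^sub>R x + \<theta> *\<^sub>R y))\<^sup>2
    = (1 - \<theta>) * (norm x)\<^sup>2 + \<theta> * (norm y)\<^sup>2 - \<theta> * (1 - \<theta>) * (norm (x - y))\<^sup>2"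
  by (simp add: power2_norm_eq_inner inner_add_left inner_add_right inner_diff_left inner_diff_right
      inner_commute algebra_simps)

lemma strongly_convex_on_norm_power2:
  fixes K :: "'a::real_inner set"
  shows "strongly_convex_on K (2 * c) (\<lambda>x. c * (norm x)\<^sup>2)"
  unfolding strongly_convex_on_def norm_convex_combination by (simp add: algebra_simps)

text \<open>Along the line through x and y, subtracting c/2 times the squared distance from x leaves
  a function of one variable with nonnegative second derivative.\<close>

lemma second_derivative_strongly_convex:
  fixes f :: "'a::real_inner \<Rightarrow> real" and g :: "'a \<Rightarrow> 'a"
  assumes S: "subspace S"
    and f: "\<And>a. a \<in> S \<Longrightarrow> (f has_derivative (\<lambda>h. g a \<bullet> h)) (at a within S)"
    and g: "\<And>a. a \<in> S \<Longrightarrow> (g has_derivative H a) (at a within S)"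
    and H: "\<And>a h. a \<in> S \<Longrightarrow> h \<in> S \<Longrightarrow> H a h \<bullet> h \<ge> c * (norm h)\<^sup>2"
  shows "strongly_convex_on S c f"
  unfolding strongly_convex_on_def
proof (intro ballI)
  fix x y and \<theta> :: real assume x: "x \<in> S" and y: "y \<in> S" and \<theta>: "\<theta> \<in> {0..1}"
  define h where "h = y - x"
  have h: "h \<in> S" unfolding h_def by (rule subspace_diff[OF S y x])
  \<comment> \<open>The entire line lies in \<open>S\<close>, so derivatives taken within
    \<open>S\<close> compose with \<open>p\<close> to ordinary derivatives on the reals.\<close>
  define p where "p s = x + s *\<^sub>R h" for s :: real
  have pS: "p s \<in> S" for s unfolding p_def using S x h by (intro subspace_add subspace_scale)
  have p': "(p has_derivative (\<lambda>s. s *\<^sub>R h)) (at t)" for t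
    unfolding p_def by (auto intro!: derivative_eq_intros)
  have fp: "((\<lambda>s. f (p s)) has_real_derivative g (p t) \<bullet> h) (at t)" for t
  proof -
    have "((\<lambda>s. f (p s)) has_derivative (\<lambda>s. g (p t) \<bullet> (s *\<^sub>R h))) (at t)"
      by (rule has_derivative_in_compose2[of S f "\<lambda>a h. g a \<bullet> h" p UNIV t "\<lambda>s. s *\<^sub>R h"])
         (use f pS p' in auto)
    then show ?thesis by (simp add: has_field_derivative_def mult_commute_abs)
  qed
  have gp: "((\<lambda>s. g (p s) \<bullet> h) has_real_derivative H (p t) h \<bullet> h) (at t)" for t
  proof -
    have "((\<lambda>s. g (p s)) has_derivative (\<lambda>s. H (p t) (s *\<^sub>R h))) (at t)"
      by (rule has_derivative_in_compose2[of S g H p UNIV t "\<lambda>s. s *\<^sub>R h"]) (use g pS p' in auto)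
    from has_derivative_inner_left[OF this, of h]
    have "((\<lambda>s. g (p s) \<bullet> h) has_derivative (\<lambda>s. H (p t) (s *\<^sub>R h) \<bullet> h)) (at t)" .
    moreover have "linear (H (p t))" using g[OF pS] by (rule has_derivative_linear)
    ultimately show ?thesis
      by (simp add: has_field_derivative_def linear_scale mult_commute_abs)
  qed
  have "convex_on UNIV (\<lambda>s. f (p s) - c / 2 * s\<^sup>2 * (norm h)\<^sup>2)"
  proof (rule f''_ge0_imp_convex[where f' = "\<lambda>s. g (p s) \<bullet> h - c * s * (norm h)\<^sup>2"
        and f'' = "\<lambda>s. H (p s) h \<bullet> h - c * (norm h)\<^sup>2"])
    show "((\<lambda>s. f (p s) - c / 2 * s\<^sup>2 * (norm h)\<^sup>2) has_real_derivative g (p t) \<bullet> h - c * t * (norm h)\<^sup>2) (at t)" for t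
      by (auto intro!: derivative_eq_intros fp)
    show "((\<lambda>s. g (p s) \<bullet> h - c * s * (norm h)\<^sup>2) has_real_derivative H (p t) h \<bullet> h - c * (norm h)\<^sup>2) (at t)" for t
      by (auto intro!: derivative_eq_intros gp)
    show "0 \<le> H (p t) h \<bullet> h - c * (norm h)\<^sup>2" for t using H[OF pS h] by simp
  qed auto
  from convex_onD[OF this, of \<theta> 0 1] \<theta>
  have "f (p \<theta>) - c / 2 * \<theta>\<^sup>2 * (norm h)\<^sup>2 \<le> (1 - \<theta>) * f (p 0) + \<theta> * (f (p 1) - c / 2 * (norm h)\<^sup>2)"
    by simp
  moreover have "p \<theta> = (1 - \<theta>) *\<^sub>R x + \<theta> *\<^sub>R y" "p 0 = x" "p 1 = y"
    by (auto simp: p_def h_def algebra_simps)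
  moreover have "c / 2 * \<theta>\<^sup>2 * (norm h)\<^sup>2 - \<theta> * (c / 2 * (norm h)\<^sup>2) = - (c / 2 * \<theta> * (1 - \<theta>) * (norm (x - y))\<^sup>2)"
    by (simp add: h_def norm_minus_commute power2_eq_square field_simps)
  ultimately show "f ((1 - \<theta>) *\<^sub>R x + \<theta> *\<^sub>R y) \<le> (1 - \<theta>) * f x + \<theta> * f y - c / 2 * \<theta> * (1 - \<theta>) * (norm (x - y))\<^sup>2"
    by (simp add: right_diff_distrib)
qed

section \<open>Rate independent systems with strongly convex energy\<close>

text \<open>Constraints live in \<open>K\<close>, whereas \<open>R\<close> is finite and sublinear
  on the whole space; thus \<open>R\<close> is convex there and hence continuous, which lets
  stability and the energy estimate pass to pointwise limits.\<close>

locale rate_independent_system =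
  fixes K :: "'a::euclidean_space set" and \<Phi> R :: "'a \<Rightarrow> real" and \<alpha> :: real
  assumes K_closed: "closed K" and K_convex: "convex K"
    and \<Phi>_cont: "continuous_on K \<Phi>" and \<alpha>_pos: "\<alpha> > 0"
    and \<Phi>_convex: "strongly_convex_on K \<alpha> \<Phi>"
    and R_scale: "r > 0 \<Longrightarrow> R (r *\<^sub>R x) = r * R x"
    and R_triangle: "R (x + y) \<le> R x + R y"
begin

definition stable :: "'a \<Rightarrow> 'a set" where
  "stable l = {x \<in> K. \<forall>y\<in>K. \<Phi> x - l \<bullet> x \<le> \<Phi> y - l \<bullet> y + R (y - x)}"

lemma R_0 [simp]: "R 0 = 0"
  using R_scale[of 2 0] by simp

lemma R_convex: "convex_on UNIV R"
proof (rule convex_onI)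
  fix t :: real and x y assume "0 < t" "t < 1"
  then show "R ((1 - t) *\<^sub>R x + t *\<^sub>R y) \<le> (1 - t) * R x + t * R y"
    using R_triangle[of "(1 - t) *\<^sub>R x" "t *\<^sub>R y"] by (simp add: R_scale)
qed auto

lemma R_cont: "continuous_on S R"
  using convex_on_continuous[OF open_UNIV R_convex] continuous_on_subset by blast

lemma R_triangle_diff: "R (z - x) \<le> R (y - x) + R (z - y)"
  using R_triangle[of "y - x" "z - y"] by simp

lemma incremental_convex: "strongly_convex_on K \<alpha> (\<lambda>y. \<Phi> y - l \<bullet> y + R (y - p))"
proof -
  have "convex_on K (\<lambda>y. - (l \<bullet> y) + R (y - p))"
  proof (rule convex_onI[OF _ K_convex])
    fix t :: real and x y assume t: "0 < t" "t < 1"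
    have "R ((1 - t) *\<^sub>R (x - p) + t *\<^sub>R (y - p)) \<le> (1 - t) * R (x - p) + t * R (y - p)"
      using convex_onD[OF R_convex] t by auto
    moreover have "(1 - t) *\<^sub>R (x - p) + t *\<^sub>R (y - p) = (1 - t) *\<^sub>R x + t *\<^sub>R y - p"
      by (simp add: algebra_simps)
    ultimately show "- (l \<bullet> ((1 - t) *\<^sub>R x + t *\<^sub>R y)) + R ((1 - t) *\<^sub>R x + t *\<^sub>R y - p)
       \<le> (1 - t) * (- (l \<bullet> x) + R (x - p)) + t * (- (l \<bullet> y) + R (y - p))"
      by (simp add: inner_add_right algebra_simps)
  qed
  from strongly_convex_on_add_convex[OF \<Phi>_convex this] show ?thesis
    by (simp add: algebra_simps)
qed

text \<open>As \<open>R 0 = 0\<close>, stability of \<open>x\<close> says that \<open>x\<close>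
  minimises the incremental functional centred at \<open>x\<close> itself, so the quadratic gap of a
  minimiser comes for free.\<close>

lemma stable_gap:
  assumes "x \<in> stable l" "y \<in> K"
  shows "\<Phi> x - l \<bullet> x + \<alpha> / 2 * (norm (y - x))\<^sup>2 \<le> \<Phi> y - l \<bullet> y + R (y - x)"
  using strongly_convex_on_minimizer_gap[OF incremental_convex[of l x] K_convex, of x y] assms
  by (auto simp: stable_def)

text \<open>\<open>y\<close> minimises the energy at the new load plus \<open>R (y - x)\<close>; it
  is stable by the triangle inequality. For the norm bound, the gap of \<open>y\<close> tested with
  \<open>x\<close> and the gap of \<open>x\<close> tested with \<open>y\<close> are added: \<Phi>
  and \<open>R\<close> cancel and \<open>\<alpha> * (norm (y - x))\<^sup>2 \<le> (l' - l) \<bullet>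
  (y - x)\<close> remains.\<close>

lemma incremental_step:
  assumes x: "x \<in> stable l"
  shows "\<exists>y. y \<in> stable l' \<and> \<alpha> * norm (y - x) \<le> norm (l' - l) \<and>
    \<Phi> y - l' \<bullet> y + R (y - x) \<le> \<Phi> x - l' \<bullet> x"
proof -
  have xK: "x \<in> K" using x by (simp add: stable_def)
  have "continuous_on K (\<lambda>y. \<Phi> y - l' \<bullet> y + R (y - x))"
    by (intro continuous_intros \<Phi>_cont continuous_on_compose2[OF R_cont[of UNIV]]) auto
  then obtain y where yK: "y \<in> K"
    and min: "\<And>w. w \<in> K \<Longrightarrow> \<Phi> y - l' \<bullet> y + R (y - x) \<le> \<Phi> w - l' \<bullet> w + R (w - x)"
    using strongly_convex_on_attains_min[OF incremental_convex \<alpha>_pos K_convex K_closed _, of l' x] xK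
    by blast
  have "y \<in> stable l'"
  proof -
    have "\<Phi> y - l' \<bullet> y \<le> \<Phi> w - l' \<bullet> w + R (w - y)" if "w \<in> K" for w
      using min[OF that] R_triangle_diff[of w x y] by simp
    then show ?thesis using yK by (simp add: stable_def)
  qed
  moreover have "\<alpha> * norm (y - x) \<le> norm (l' - l)"
  proof (cases "y = x")
    case False
    have "\<Phi> y - l' \<bullet> y + R (y - x) + \<alpha> / 2 * (norm (x - y))\<^sup>2 \<le> \<Phi> x - l' \<bullet> x"
      using strongly_convex_on_minimizer_gap[OF incremental_convex[of l' x] K_convex yK min xK] by simp
    then have "\<alpha> * (norm (y - x))\<^sup>2 \<le> (l' - l) \<bullet> (y - x)"
      using stable_gap[OF x yK] by (simp add: norm_minus_commute algebra_simps)
    also have "\<dots> \<le> norm (l' - l) * norm (y - x)" by (rule norm_cauchy_schwarz)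
    finally show ?thesis using False by (simp add: power2_eq_square)
  qed simp
  moreover have "\<Phi> y - l' \<bullet> y + R (y - x) \<le> \<Phi> x - l' \<bullet> x" using min[OF xK] by simp
  ultimately show ?thesis by blast
qed

text \<open>The estimates are stated between arbitrary indices j and k, with an error independent of
  the number of steps, so that they survive refinement of the grid.\<close>

lemma discrete_solution:
  fixes l :: "nat \<Rightarrow> 'a" and v :: "nat \<Rightarrow> real"
  assumes x0: "x0 \<in> stable (l 0)" and v: "\<And>k. norm (l (Suc k) - l k) \<le> v (Suc k) - v k"
  shows "\<exists>x. x 0 = x0 \<and> (\<forall>k. x k \<in> stable (l k)) \<and>
    (\<forall>j k. j \<le> k \<longrightarrow> \<alpha> * norm (x k - x j) \<le> v k - v j \<and>
       \<Phi> (x k) - l k \<bullet> x k + R (x k - x j)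
         \<le> \<Phi> (x j) - l j \<bullet> x j - (l k - l j) \<bullet> x j + (v k - v j)\<^sup>2 / \<alpha>)"
proof -
  have "\<exists>x. \<forall>k. (x k \<in> stable (l k) \<and> (k = 0 \<longrightarrow> x k = x0)) \<and>
     (\<alpha> * norm (x (Suc k) - x k) \<le> norm (l (Suc k) - l k) \<and>
      \<Phi> (x (Suc k)) - l (Suc k) \<bullet> x (Suc k) + R (x (Suc k) - x k) \<le> \<Phi> (x k) - l (Suc k) \<bullet> x k)"
    by (rule dependent_nat_choice) (use x0 incremental_step in auto)
  then obtain x where x: "\<And>k. x k \<in> stable (l k)" "x 0 = x0"
    and lip: "\<And>k. \<alpha> * norm (x (Suc k) - x k) \<le> norm (l (Suc k) - l k)"
    and en: "\<And>k. \<Phi> (x (Suc k)) - l (Suc k) \<bullet> x (Suc k) + R (x (Suc k) - x k) \<le> \<Phi> (x k) - l (Suc k) \<bullet> x k"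
    by auto
  have main: "\<alpha> * norm (x k - x j) \<le> v k - v j \<and>
       \<Phi> (x k) - l k \<bullet> x k + R (x k - x j)
         \<le> \<Phi> (x j) - l j \<bullet> x j - (l k - l j) \<bullet> x j + (v k - v j)\<^sup>2 / \<alpha>" if "j \<le> k" for j k
    using that
  proof (induction k rule: dec_induct)
    case base
    then show ?case by simp
  next
    case (step k)
    have n1: "\<alpha> * norm (x (Suc k) - x j) \<le> \<alpha> * norm (x (Suc k) - x k) + \<alpha> * norm (x k - x j)"
      using \<alpha>_pos norm_triangle_ineq[of "x (Suc k) - x k" "x k - x j"]
      by (simp flip: distrib_left)
    have v0: "0 \<le> v (Suc k) - v k" using v[of k] norm_ge_zero order_trans by blast
    have v1: "0 \<le> v k - v j" using step(3) \<alpha>_pos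
      by (smt (verit) mult_nonneg_nonneg norm_ge_zero)
    \<comment> \<open>A single step produces work against \<open>x k\<close>, but the claim has it
      against \<open>x j\<close>. The exchange costs a product of two increments of
      \<open>v\<close>, which the growth of the square absorbs.\<close>
    have "(l k - l (Suc k)) \<bullet> (x k - x j) \<le> norm (l (Suc k) - l k) * norm (x k - x j)"
      using norm_cauchy_schwarz[of "l k - l (Suc k)" "x k - x j"] by (simp add: norm_minus_commute)
    also have "\<dots> \<le> (v (Suc k) - v k) * ((v k - v j) / \<alpha>)"
      using step(3) \<alpha>_pos v[of k] v0 by (intro mult_mono) (auto simp: field_simps)
    finally have cross: "(l k - l (Suc k)) \<bullet> (x k - x j) \<le> (v (Suc k) - v k) * (v k - v j) / \<alpha>" by simp
    have "(v k - v j)\<^sup>2 + (v (Suc k) - v k) * (v k - v j) \<le> (v (Suc k) - v j)\<^sup>2"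
    proof -
      have "(v (Suc k) - v j)\<^sup>2 - ((v k - v j)\<^sup>2 + (v (Suc k) - v k) * (v k - v j))
         = (v (Suc k) - v k) * (v (Suc k) - v k + (v k - v j))"
        by (simp add: algebra_simps power2_eq_square)
      then show ?thesis using v0 v1 by (smt (verit) mult_nonneg_nonneg)
    qed
    then have "(v k - v j)\<^sup>2 / \<alpha> + (v (Suc k) - v k) * (v k - v j) / \<alpha> \<le> (v (Suc k) - v j)\<^sup>2 / \<alpha>"
      using \<alpha>_pos by (simp add: divide_right_mono flip: add_divide_distrib)
    moreover note en[of k] step(3) R_triangle_diff[of "x (Suc k)" "x j" "x k"] cross
    ultimately have "\<Phi> (x (Suc k)) - l (Suc k) \<bullet> x (Suc k) + R (x (Suc k) - x j)
         \<le> \<Phi> (x j) - l j \<bullet> x j - (l (Suc k) - l j) \<bullet> x j + (v (Suc k) - v j)\<^sup>2 / \<alpha>"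
      by (simp add: inner_diff_left inner_diff_right)
    then show ?case using n1 lip[of k] v[of k] step(3) by auto
  qed
  show ?thesis using x main by auto
qed

end

text \<open>The index set may be uncountable, as the set of times is, so a subsequence converging at
  every index cannot be expected; a finer filter on the indices does the same work in limit
  arguments.\<close>

lemma pointwise_cluster_filter:
  fixes f :: "nat \<Rightarrow> 'i \<Rightarrow> 'b::heine_borel"
  assumes "\<And>i. bounded (range (\<lambda>n. f n i))"
  shows "\<exists>G g. G \<le> sequentially \<and> G \<noteq> bot \<and> (\<forall>i. ((\<lambda>n. f n i) \<longlongrightarrow> g i) G)"
proof -
  define B where "B i = closure (range (\<lambda>n. f n i))" for i
  have B: "compact (B i)" for i unfolding B_def using assms compact_closure by blast
  have "compactin (product_topology (\<lambda>i. euclidean) UNIV) (PiE UNIV B)"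
    using B by (simp add: compactin_PiE)
  then have "compact (PiE UNIV B)" by (simp add: euclidean_product_topology)
  moreover have "eventually (\<lambda>h. h \<in> PiE UNIV B) (filtermap f sequentially)"
    unfolding eventually_filtermap B_def
    using closure_subset by (intro always_eventually) fastforce
  moreover have "filtermap f sequentially \<noteq> bot" by (simp add: filtermap_bot_iff)
  ultimately obtain g where g: "inf (nhds g) (filtermap f sequentially) \<noteq> bot"
    unfolding compact_filter by blast
  \<comment> \<open>Pulling the neighbourhoods of the cluster point back along \<open>f\<close>
    forces convergence to \<open>g\<close>; that \<open>g\<close> is a cluster point is what keeps
    the filter proper.\<close>
  define G where "G = inf (filtercomap f (nhds g)) sequentially"
  have "G \<noteq> bot"
  proof
    assume "G = bot"
    then obtain P Q where PQ: "eventually P (nhds g)" "eventually Q sequentially"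
      "\<And>n. P (f n) \<Longrightarrow> Q n \<Longrightarrow> False"
      by (auto simp: trivial_limit_def G_def eventually_inf eventually_filtercomap)
    have "eventually (\<lambda>h. \<not> P h) (filtermap f sequentially)"
      unfolding eventually_filtermap using PQ(2) by eventually_elim (use PQ(3) in blast)
    then have "eventually (\<lambda>_. False) (inf (nhds g) (filtermap f sequentially))"
      using PQ(1) unfolding eventually_inf by blast
    then show False using g by (simp add: trivial_limit_def)
  qed
  moreover have "(f \<longlongrightarrow> g) G"
    unfolding G_def filterlim_def
    by (metis filtermap_filtercomap filtermap_mono inf_le1 order_trans)
  then have "((\<lambda>n. f n i) \<longlongrightarrow> g i) G" for i
    using continuous_on_tendsto_compose[OF continuous_on_product_coordinates[of i], of f g G] by simp
  ultimately show ?thesis by (intro exI[of _ G] exI[of _ g]) (auto simp: G_def)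
qed

section \<open>Passage to the limit and the two energy inequalities\<close>

context rate_independent_system
begin

text \<open>Posed on the half-line, so that the grids with step 1/(N+1) need not be fitted to a
  final time.\<close>

lemma evolution_exists:
  fixes l :: "real \<Rightarrow> 'a" and V :: "real \<Rightarrow> real"
  assumes x0: "x0 \<in> stable (l 0)"
    and l: "continuous_on {0..} l" and V: "continuous_on {0..} V"
    and lV: "\<And>s t. 0 \<le> s \<Longrightarrow> s \<le> t \<Longrightarrow> norm (l t - l s) \<le> V t - V s"
  shows "\<exists>q. q 0 = x0 \<and> (\<forall>t\<ge>0. q t \<in> stable (l t)) \<and>
    (\<forall>s t. 0 \<le> s \<longrightarrow> s \<le> t \<longrightarrow> \<alpha> * norm (q t - q s) \<le> V t - V s \<and>
       \<Phi> (q t) - l t \<bullet> q t + R (q t - q s)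
         \<le> \<Phi> (q s) - l s \<bullet> q s - (l t - l s) \<bullet> q s + (V t - V s)\<^sup>2 / \<alpha>)"
proof -
  have ex: "\<exists>x. x 0 = x0 \<and> (\<forall>k. x k \<in> stable (l (real k / real (Suc N)))) \<and>
    (\<forall>j k. j \<le> k \<longrightarrow> \<alpha> * norm (x k - x j) \<le> V (real k / real (Suc N)) - V (real j / real (Suc N)) \<and>
       \<Phi> (x k) - l (real k / real (Suc N)) \<bullet> x k + R (x k - x j)
         \<le> \<Phi> (x j) - l (real j / real (Suc N)) \<bullet> x j - (l (real k / real (Suc N)) - l (real j / real (Suc N))) \<bullet> x j
            + (V (real k / real (Suc N)) - V (real j / real (Suc N)))\<^sup>2 / \<alpha>)" for N
    using x0 by (intro discrete_solution) (auto intro!: lV divide_right_mono)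
  obtain x where x_0: "\<And>N. x N 0 = x0" 
    and xst: "\<And>N k. x N k \<in> stable (l (real k / real (Suc N)))"
    and xlip: "\<And>N j k. j \<le> k \<Longrightarrow> \<alpha> * norm (x N k - x N j) \<le> V (real k / real (Suc N)) - V (real j / real (Suc N))"
    and xen: "\<And>N j k. j \<le> k \<Longrightarrow> \<Phi> (x N k) - l (real k / real (Suc N)) \<bullet> x N k + R (x N k - x N j)
         \<le> \<Phi> (x N j) - l (real j / real (Suc N)) \<bullet> x N j - (l (real k / real (Suc N)) - l (real j / real (Suc N))) \<bullet> x N j
            + (V (real k / real (Suc N)) - V (real j / real (Suc N)))\<^sup>2 / \<alpha>"
    using choice[of "\<lambda>N x. x 0 = x0 \<and> (\<forall>k. x k \<in> stable (l (real k / real (Suc N)))) \<and>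
    (\<forall>j k. j \<le> k \<longrightarrow> \<alpha> * norm (x k - x j) \<le> V (real k / real (Suc N)) - V (real j / real (Suc N)) \<and>
       \<Phi> (x k) - l (real k / real (Suc N)) \<bullet> x k + R (x k - x j)
         \<le> \<Phi> (x j) - l (real j / real (Suc N)) \<bullet> x j - (l (real k / real (Suc N)) - l (real j / real (Suc N))) \<bullet> x j
            + (V (real k / real (Suc N)) - V (real j / real (Suc N)))\<^sup>2 / \<alpha>)"] ex by blast
  \<comment> \<open>For nonnegative t this is the last grid index not after t; \<open>nat\<close>
    sends negative times to index 0, so the interpolant is defined for every real t.\<close>
  define k where "k N t = nat \<lfloor>t * real (Suc N)\<rfloor>" for N and t :: real
  define \<tau> where "\<tau> N t = real (k N t) / real (Suc N)" for N t
  have k_mono: "k N s \<le> k N t" if "s \<le> t" for N s t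
    unfolding k_def using that by (intro nat_mono floor_mono mult_right_mono) auto
  have \<tau>_nonneg: "0 \<le> \<tau> N t" for N t by (simp add: \<tau>_def)
  have \<tau>_le: "\<tau> N t \<le> t" if "t \<ge> 0" for N t
  proof -
    have "real (k N t) \<le> t * real (Suc N)"
      unfolding k_def using that by (simp add: of_nat_nat)
    then show ?thesis by (simp add: \<tau>_def pos_divide_le_eq del: of_nat_Suc)
  qed
  have \<tau>_ge: "t - 1 / real (Suc N) \<le> \<tau> N t" if "t \<ge> 0" for N t
  proof -
    have "t * real (Suc N) - 1 \<le> real (k N t)"
      unfolding k_def using that by linarith
    then have "(t * real (Suc N) - 1) / real (Suc N) \<le> \<tau> N t"
      unfolding \<tau>_def by (rule divide_right_mono) simp
    then show ?thesis by (simp add: diff_divide_distrib del: of_nat_Suc)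
  qed
  have \<tau>_lim: "(\<lambda>N. \<tau> N t) \<longlonglongrightarrow> t" if "t \<ge> 0" for t
  proof (rule tendsto_sandwich)
    show "(\<lambda>N. t - 1 / real (Suc N)) \<longlonglongrightarrow> t"
      using tendsto_diff[OF tendsto_const[of t] LIMSEQ_inverse_real_of_nat] by (simp add: inverse_eq_divide)
  qed (use \<tau>_le[OF that] \<tau>_ge[OF that] in auto)
  have \<tau>_0: "\<tau> N 0 = 0" "k N 0 = 0" for N by (simp_all add: \<tau>_def k_def)
  have "bounded (range (\<lambda>N. x N (k N t)))" for t
  proof -
    \<comment> \<open>The compactness lemma asks for boundedness at every real t;
      \<open>max t 0\<close> covers negative times, where the interpolant is
      \<open>x0\<close>.\<close>
    have "norm (x N (k N t) - x0) \<le> (V (max t 0) - V 0) / \<alpha>" for N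
    proof -
      have "\<alpha> * norm (x N (k N t) - x0) \<le> V (\<tau> N t) - V 0"
        using xlip[of 0 "k N t" N] by (simp add: x_0 \<tau>_def)
      also have "\<dots> \<le> V (max t 0) - V 0"
      proof -
        have "\<tau> N t \<le> max t 0"
          using \<tau>_le[of "max t 0" N] k_mono[of t "max t 0" N]
          by (smt (verit, best) \<tau>_def divide_right_mono of_nat_0_le_iff of_nat_le_iff)
        then have "0 \<le> V (max t 0) - V (\<tau> N t)"
          using lV[OF \<tau>_nonneg] norm_ge_zero order_trans by blast
        then show ?thesis by simp
      qed
      finally show ?thesis using \<alpha>_pos by (simp add: field_simps)
    qed
    then have "range (\<lambda>N. x N (k N t)) \<subseteq> cball x0 ((V (max t 0) - V 0) / \<alpha>)"
      by (auto simp: dist_norm norm_minus_commute)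
    then show ?thesis using bounded_cball bounded_subset by blast
  qed
  from pointwise_cluster_filter[of "\<lambda>N t. x N (k N t)", OF this]
  obtain G q where G: "G \<le> sequentially" "G \<noteq> bot" and q: "\<And>t. ((\<lambda>N. x N (k N t)) \<longlongrightarrow> q t) G"
    by blast
  have \<tau>G: "((\<lambda>N. \<tau> N t) \<longlongrightarrow> t) G" if "t \<ge> 0" for t
    using \<tau>_lim[OF that] G(1) tendsto_mono by blast
  have lG: "((\<lambda>N. l (\<tau> N t)) \<longlongrightarrow> l t) G" if "t \<ge> 0" for t
    by (rule continuous_on_tendsto_compose[OF l \<tau>G[OF that]]) (use that \<tau>_nonneg in auto)
  have VG: "((\<lambda>N. V (\<tau> N t)) \<longlongrightarrow> V t) G" if "t \<ge> 0" for t
    by (rule continuous_on_tendsto_compose[OF V \<tau>G[OF that]]) (use that \<tau>_nonneg in auto)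
  have xK: "x N j \<in> K" for N j using xst by (simp add: stable_def)
  have qK: "q t \<in> K" for t
    using Lim_in_closed_set[OF K_closed _ G(2) q] xK by (simp add: always_eventually)
  have \<Phi>G: "((\<lambda>N. \<Phi> (x N (k N t))) \<longlongrightarrow> \<Phi> (q t)) G" for t
    by (rule continuous_on_tendsto_compose[OF \<Phi>_cont q]) (use xK qK in auto)
  have RG: "((\<lambda>N. R (f N)) \<longlongrightarrow> R y) G" if "(f \<longlongrightarrow> y) G" for f y
    by (rule continuous_on_tendsto_compose[OF R_cont[of UNIV] that]) auto
  note lims = q lG VG \<Phi>G RG
  have "q 0 = x0"
    using tendsto_unique[OF G(2) q[of 0]] by (simp add: \<tau>_0 x_0)
  moreover have "q t \<in> stable (l t)" if "t \<ge> 0" for t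
  proof -
    have "\<Phi> (q t) - l t \<bullet> q t \<le> \<Phi> y - l t \<bullet> y + R (y - q t)" if y: "y \<in> K" for y
    proof (rule tendsto_le[OF G(2)])
      show "((\<lambda>N. \<Phi> y - l (\<tau> N t) \<bullet> y + R (y - x N (k N t))) \<longlongrightarrow> \<Phi> y - l t \<bullet> y + R (y - q t)) G"
        by (intro tendsto_intros lims \<open>t \<ge> 0\<close>)
      show "((\<lambda>N. \<Phi> (x N (k N t)) - l (\<tau> N t) \<bullet> x N (k N t)) \<longlongrightarrow> \<Phi> (q t) - l t \<bullet> q t) G"
        by (intro tendsto_intros lims \<open>t \<ge> 0\<close>)
      show "\<forall>\<^sub>F N in G. \<Phi> (x N (k N t)) - l (\<tau> N t) \<bullet> x N (k N t)
              \<le> \<Phi> y - l (\<tau> N t) \<bullet> y + R (y - x N (k N t))"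
        using xst y by (intro always_eventually) (auto simp: stable_def \<tau>_def)
    qed
    then show ?thesis using qK by (simp add: stable_def)
  qed
  moreover have "\<alpha> * norm (q t - q s) \<le> V t - V s \<and>
       \<Phi> (q t) - l t \<bullet> q t + R (q t - q s)
         \<le> \<Phi> (q s) - l s \<bullet> q s - (l t - l s) \<bullet> q s + (V t - V s)\<^sup>2 / \<alpha>" if st: "0 \<le> s" "s \<le> t" for s t
  proof
    have t: "0 \<le> t" using st by simp
    show "\<alpha> * norm (q t - q s) \<le> V t - V s"
    proof (rule tendsto_le[OF G(2)])
      show "((\<lambda>N. V (\<tau> N t) - V (\<tau> N s)) \<longlongrightarrow> V t - V s) G"
        by (intro tendsto_intros lims st t)
      show "((\<lambda>N. \<alpha> * norm (x N (k N t) - x N (k N s))) \<longlongrightarrow> \<alpha> * norm (q t - q s)) G"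
        by (intro tendsto_intros lims st t)
    qed (use xlip[OF k_mono[OF st(2)]] in \<open>simp add: \<tau>_def\<close>)
    show "\<Phi> (q t) - l t \<bullet> q t + R (q t - q s)
         \<le> \<Phi> (q s) - l s \<bullet> q s - (l t - l s) \<bullet> q s + (V t - V s)\<^sup>2 / \<alpha>"
    proof (rule tendsto_le[OF G(2)])
      show "((\<lambda>N. \<Phi> (x N (k N s)) - l (\<tau> N s) \<bullet> x N (k N s) - (l (\<tau> N t) - l (\<tau> N s)) \<bullet> x N (k N s)
         + (V (\<tau> N t) - V (\<tau> N s))\<^sup>2 / \<alpha>)
         \<longlongrightarrow> \<Phi> (q s) - l s \<bullet> q s - (l t - l s) \<bullet> q s + (V t - V s)\<^sup>2 / \<alpha>) G"
        using \<alpha>_pos by (intro tendsto_intros lims st t) auto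
      show "((\<lambda>N. \<Phi> (x N (k N t)) - l (\<tau> N t) \<bullet> x N (k N t) + R (x N (k N t) - x N (k N s)))
         \<longlongrightarrow> \<Phi> (q t) - l t \<bullet> q t + R (q t - q s)) G"
        by (intro tendsto_intros lims st t)
    qed (use xen[OF k_mono[OF st(2)]] in \<open>simp add: \<tau>_def\<close>)
  qed
  ultimately show ?thesis by blast
qed

text \<open>The last two conclusions are the halves of the energy balance. The second one holds
  along a partition and up to \<open>e\<close>, which is the form that matches a dissipation defined
  as a supremum.\<close>

lemma energetic_evolution:
  fixes l l' :: "real \<Rightarrow> 'a"
  assumes "T > 0" and x0: "x0 \<in> stable (l 0)" and l': "l' absolutely_integrable_on {0..T}"
    and l: "\<And>s t. 0 \<le> s \<Longrightarrow> s \<le> t \<Longrightarrow> t \<le> T \<Longrightarrow> l t - l s = integral {s..t} l'"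
  obtains q where "q 0 = x0" "\<And>t. t \<in> {0..T} \<Longrightarrow> q t \<in> stable (l t)" "continuous_on {0..T} q"
    "\<And>s t. 0 \<le> s \<Longrightarrow> s \<le> t \<Longrightarrow> t \<le> T \<Longrightarrow>
       norm (q t - q s) \<le> integral {s..t} (\<lambda>r. norm (l' r) / \<alpha>)"
    "\<And>s t. 0 \<le> s \<Longrightarrow> s \<le> t \<Longrightarrow> t \<le> T \<Longrightarrow>
       \<Phi> (q t) - l t \<bullet> q t + integral {s..t} (\<lambda>r. q r \<bullet> l' r) + R (q t - q s) \<le> \<Phi> (q s) - l s \<bullet> q s"
    "\<And>t e. t \<in> {0..T} \<Longrightarrow> e > 0 \<Longrightarrow> \<exists>(N::nat) \<tau>. \<tau> 0 = 0 \<and> \<tau> N = t \<and> (\<forall>i<N. \<tau> i < \<tau> (Suc i)) \<and>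
       \<Phi> (q 0) - l 0 \<bullet> q 0 \<le> \<Phi> (q t) - l t \<bullet> q t + integral {0..t} (\<lambda>r. q r \<bullet> l' r)
         + (\<Sum>i<N. R (q (\<tau> (Suc i)) - q (\<tau> i))) + e"
proof -
  have li: "l' integrable_on {0..T}" and nli: "(\<lambda>r. norm (l' r)) integrable_on {0..T}"
    using l' by (auto simp: absolutely_integrable_on_def)
  define V where "V t = integral {0..t} (\<lambda>r. norm (l' r))" for t
  have Vinc: "V t - V s = integral {s..t} (\<lambda>r. norm (l' r))" if "0 \<le> s" "s \<le> t" "t \<le> T" for s t
    unfolding V_def by (rule integral_increment[OF nli that])
  have Vcont: "continuous_on {0..T} V" unfolding V_def by (rule indefinite_integral_continuous_1[OF nli])
  have lV: "norm (l t - l s) \<le> V t - V s" if "0 \<le> s" "s \<le> t" "t \<le> T" for s t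
    unfolding Vinc[OF that] l[OF that] using that
    by (intro Henstock_Kurzweil_Integration.integral_norm_bound_integral
        integrable_on_subinterval[OF li] integrable_on_subinterval[OF nli]) auto
  have Vmono: "mono_on {0..T} V"
  proof (rule mono_onI)
    fix s t assume "s \<in> {0..T}" "t \<in> {0..T}" "s \<le> t"
    then show "V s \<le> V t" using order_trans[OF norm_ge_zero lV[of s t]] by simp
  qed
  have "continuous_on {0..T} (\<lambda>t. l 0 + integral {0..t} l')"
    by (intro continuous_intros indefinite_integral_continuous_1 li)
  moreover have "l 0 + integral {0..t} l' = l t" if "t \<in> {0..T}" for t
    using l[of 0 t] that by (simp add: algebra_simps)
  ultimately have lcont: "continuous_on {0..T} l" by (rule continuous_on_eq)
  \<comment> \<open>The load is frozen after time T, which makes it a load on the half-line.\<close>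
  have clamp: "continuous_on {0..} (\<lambda>t. min T t)" by (intro continuous_intros)
  have "\<exists>q. q 0 = x0 \<and> (\<forall>t\<ge>0. q t \<in> stable (l (min T t))) \<and>
    (\<forall>s t. 0 \<le> s \<longrightarrow> s \<le> t \<longrightarrow> \<alpha> * norm (q t - q s) \<le> V (min T t) - V (min T s) \<and>
       \<Phi> (q t) - l (min T t) \<bullet> q t + R (q t - q s)
         \<le> \<Phi> (q s) - l (min T s) \<bullet> q s - (l (min T t) - l (min T s)) \<bullet> q s + (V (min T t) - V (min T s))\<^sup>2 / \<alpha>)"
  proof (rule evolution_exists)
    show "continuous_on {0..} (\<lambda>t. l (min T t))" "continuous_on {0..} (\<lambda>t. V (min T t))"
      using \<open>T > 0\<close>
      by (auto intro!: continuous_on_compose2[OF lcont clamp] continuous_on_compose2[OF Vcont clamp])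
  qed (use x0 \<open>T > 0\<close> lV in \<open>auto intro!: lV\<close>)
  then obtain q where q0: "q 0 = x0" and "\<And>t. t \<ge> 0 \<Longrightarrow> q t \<in> stable (l (min T t))"
    and "\<And>s t. 0 \<le> s \<Longrightarrow> s \<le> t \<Longrightarrow> \<alpha> * norm (q t - q s) \<le> V (min T t) - V (min T s)"
    and "\<And>s t. 0 \<le> s \<Longrightarrow> s \<le> t \<Longrightarrow> \<Phi> (q t) - l (min T t) \<bullet> q t + R (q t - q s)
         \<le> \<Phi> (q s) - l (min T s) \<bullet> q s - (l (min T t) - l (min T s)) \<bullet> q s + (V (min T t) - V (min T s))\<^sup>2 / \<alpha>"
    by blast
  note q = this
  have qst: "q t \<in> stable (l t)" if "t \<in> {0..T}" for t
    using q(2)[of t] that by simp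
  have qlip: "norm (q t - q s) \<le> (V t - V s) / \<alpha>" if "0 \<le> s" "s \<le> t" "t \<le> T" for s t
    using q(3)[of s t] that \<alpha>_pos by (simp add: field_simps)
  have qen: "\<Phi> (q t) - l t \<bullet> q t + R (q t - q s)
         \<le> \<Phi> (q s) - l s \<bullet> q s - (l t - l s) \<bullet> q s + (V t - V s)\<^sup>2 / \<alpha>" if "0 \<le> s" "s \<le> t" "t \<le> T" for s t
    using q(4)[of s t] that by simp
  have qcont: "continuous_on {0..T} q"
    unfolding continuous_on_iff
  proof (intro ballI allI impI)
    fix x e :: real assume x: "x \<in> {0..T}" and e: "0 < e"
    then obtain d where d: "d > 0" "\<And>y. y \<in> {0..T} \<Longrightarrow> dist y x < d \<Longrightarrow> dist (V y) (V x) < e * \<alpha>"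
      using Vcont \<alpha>_pos unfolding continuous_on_iff by (metis mult_pos_pos)
    have "dist (q y) (q x) < e" if y: "y \<in> {0..T}" "dist y x < d" for y
    proof -
      have "norm (q y - q x) \<le> \<bar>V y - V x\<bar> / \<alpha>"
      proof (cases "x \<le> y")
        case True
        then have "norm (q y - q x) \<le> (V y - V x) / \<alpha>" using qlip[of x y] x y(1) by simp
        also have "\<dots> \<le> \<bar>V y - V x\<bar> / \<alpha>" using \<alpha>_pos by (intro divide_right_mono) auto
        finally show ?thesis .
      next
        case False
        then have "norm (q y - q x) \<le> (V x - V y) / \<alpha>"
          using qlip[of y x] x y(1) by (simp add: norm_minus_commute)
        also have "\<dots> \<le> \<bar>V y - V x\<bar> / \<alpha>" using \<alpha>_pos by (intro divide_right_mono) auto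
        finally show ?thesis .
      qed
      also have "\<dots> < e" using d(2)[OF y] \<alpha>_pos by (simp add: dist_real_def field_simps)
      finally show ?thesis by (simp add: dist_norm)
    qed
    then show "\<exists>d>0. \<forall>x'\<in>{0..T}. dist x' x < d \<longrightarrow> dist (q x') (q x) < e" using d(1) by blast
  qed
  have qli: "(\<lambda>r. q r \<bullet> l' r) integrable_on {0..T}"
    using absolutely_integrable_continuous_inner[OF qcont l'] by (simp add: absolutely_integrable_on_def)
  define J where "J s t = integral {s..t} (\<lambda>r. q r \<bullet> l' r)" for s t
  have J: "J 0 t - J 0 s = J s t" if "0 \<le> s" "s \<le> t" "t \<le> T" for s t
    unfolding J_def by (rule integral_increment[OF qli that])
  \<comment> \<open>\<open>p\<close> is arbitrary because both ends are used: p = s for the upper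
    energy estimate, p = t for the lower one.\<close>
  have Jerr: "\<bar>J s t - (l t - l s) \<bullet> q p\<bar> \<le> (V t - V s)\<^sup>2 / \<alpha>" if st: "0 \<le> s" "s \<le> t" "t \<le> T" and p: "p \<in> {s..t}" for s t p
  proof -
    have lst: "l' integrable_on {s..t}" and nlst: "(\<lambda>r. norm (l' r)) integrable_on {s..t}"
      and qlst: "(\<lambda>r. q r \<bullet> l' r) integrable_on {s..t}"
      using li nli qli st by (auto intro: integrable_on_subinterval)
    have pl: "((\<lambda>r. q p \<bullet> l' r) has_integral q p \<bullet> (l t - l s)) {s..t}"
      using has_integral_linear[OF integrable_integral[OF lst] bounded_linear_inner_right[of "q p"]] l[OF st]
      by (simp add: o_def)
    have "J s t - (l t - l s) \<bullet> q p = integral {s..t} (\<lambda>r. q r \<bullet> l' r - q p \<bullet> l' r)"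
      using pl integral_diff[OF qlst, of "\<lambda>r. q p \<bullet> l' r"] by (auto simp: J_def inner_commute integral_unique)
    also have "norm \<dots> \<le> integral {s..t} (\<lambda>r. (V t - V s) / \<alpha> * norm (l' r))"
    proof (rule Henstock_Kurzweil_Integration.integral_norm_bound_integral)
      show "(\<lambda>r. q r \<bullet> l' r - q p \<bullet> l' r) integrable_on {s..t}"
        using qlst pl by (intro integrable_diff) auto
      show "(\<lambda>r. (V t - V s) / \<alpha> * norm (l' r)) integrable_on {s..t}"
        using integrable_cmul[OF nlst, of "(V t - V s) / \<alpha>"] by simp
      fix r assume r: "r \<in> {s..t}"
      have "norm (q r - q p) \<le> (V (max p r) - V (min p r)) / \<alpha>"
        using qlip[of "min p r" "max p r"] p r st by (auto simp: min_def max_def norm_minus_commute)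
      also have "\<dots> \<le> (V t - V s) / \<alpha>"
      proof -
        have "V s \<le> V (min p r)" "V (max p r) \<le> V t"
          using p r st by (auto intro!: mono_onD[OF Vmono] simp: min_def max_def)
        then show ?thesis using \<alpha>_pos by (intro divide_right_mono) auto
      qed
      finally have "norm (q r - q p) * norm (l' r) \<le> (V t - V s) / \<alpha> * norm (l' r)"
        by (rule mult_right_mono) simp
      moreover have "norm ((q r - q p) \<bullet> l' r) \<le> norm (q r - q p) * norm (l' r)"
        by (simp add: Cauchy_Schwarz_ineq2)
      ultimately show "norm (q r \<bullet> l' r - q p \<bullet> l' r) \<le> (V t - V s) / \<alpha> * norm (l' r)"
        by (simp add: inner_diff_left)
    qed
    also have "\<dots> = (V t - V s)\<^sup>2 / \<alpha>"
      using Vinc[OF st] by (simp add: power2_eq_square)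
    finally show ?thesis by simp
  qed
  define G where "G t = \<Phi> (q t) - l t \<bullet> q t + J 0 t" for t
  have up: "G t - G s + R (q t - q s) \<le> 2 / \<alpha> * (V t - V s)\<^sup>2" if st: "0 \<le> s" "s \<le> t" "t \<le> T" for s t
    using qen[OF st] Jerr[OF st, of s] J[OF st] st by (simp add: G_def)
  \<comment> \<open>Stability at the earlier time s is tested with the later state
    \<open>q t\<close>, which leaves work against \<open>q t\<close>.\<close>
  have low: "G s - G t \<le> R (q t - q s) + (V t - V s)\<^sup>2 / \<alpha>" if st: "0 \<le> s" "s \<le> t" "t \<le> T" for s t
  proof -
    have "\<Phi> (q s) - l s \<bullet> q s \<le> \<Phi> (q t) - l s \<bullet> q t + R (q t - q s)"
      using qst[of s] qst[of t] st by (auto simp: stable_def)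
    then show ?thesis
      using Jerr[OF st, of t] J[OF st] st by (simp add: G_def inner_diff_left)
  qed
  have dec: "G t - G s + R (q t - q s) \<le> 0" if st: "0 \<le> s" "s \<le> t" "t \<le> T" for s t
  proof (rule subadditive_quadratic_nonpos[where a = s and b = t and A = V and c = "2 / \<alpha>"
        and d = "\<lambda>s t. G t - G s + R (q t - q s)"])
    show "continuous_on {s..t} V" using Vcont by (rule continuous_on_subset) (use st in auto)
    show "mono_on {s..t} V" using Vmono by (rule mono_on_subset) (use st in auto)
    show "G u - G r + R (q u - q r) \<le> G p - G r + R (q p - q r) + (G u - G p + R (q u - q p))" for r p u
      using R_triangle_diff[of "q u" "q r" "q p"] by simp
  qed (use st \<alpha>_pos up in auto)
  have diss: "\<Phi> (q t) - l t \<bullet> q t + J s t + R (q t - q s) \<le> \<Phi> (q s) - l s \<bullet> q s"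
    if st: "0 \<le> s" "s \<le> t" "t \<le> T" for s t
    using J[OF st] dec[OF st] by (simp add: G_def)
  \<comment> \<open>Unlike in \<open>dec\<close>, the \<open>R\<close> terms cannot be merged into
    one increment: the triangle inequality bounds their sum from below, so the partition stays in
    the statement. The threshold \<open>\<alpha> * e\<close> compensates the division by \<alpha> in
    \<open>low\<close>.\<close>
  have fine: "\<exists>(N::nat) \<tau>. \<tau> 0 = 0 \<and> \<tau> N = t \<and> (\<forall>i<N. \<tau> i < \<tau> (Suc i)) \<and>
       \<Phi> (q 0) - l 0 \<bullet> q 0 \<le> \<Phi> (q t) - l t \<bullet> q t + J 0 t + (\<Sum>i<N. R (q (\<tau> (Suc i)) - q (\<tau> i))) + e"
    if t: "t \<in> {0..T}" and e: "e > 0" for t e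
  proof -
    have sub: "{0..t} \<subseteq> {0..T}" using t by auto
    have pos: "0 \<le> t" "\<alpha> * e > 0" using t e \<alpha>_pos by auto
    obtain N :: nat and \<tau> where \<tau>: "\<tau> 0 = 0" "\<tau> N = t"
      "\<And>i. i < N \<Longrightarrow> \<tau> i < \<tau> (Suc i)" "\<And>i. i \<le> N \<Longrightarrow> \<tau> i \<in> {0..t}"
      "(\<Sum>i<N. (V (\<tau> (Suc i)) - V (\<tau> i))\<^sup>2) \<le> \<alpha> * e"
      by (rule fine_partition[OF pos(1) continuous_on_subset[OF Vcont sub] mono_on_subset[OF Vmono sub] pos(2)]) blast
    have "G (\<tau> 0) - G (\<tau> N) \<le> (\<Sum>i<N. G (\<tau> i) - G (\<tau> (Suc i)))"
      by (subst sum_lessThan_telescope') simp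
    also have "\<dots> \<le> (\<Sum>i<N. R (q (\<tau> (Suc i)) - q (\<tau> i)) + (V (\<tau> (Suc i)) - V (\<tau> i))\<^sup>2 / \<alpha>)"
    proof (intro sum_mono low)
      fix i assume "i \<in> {..<N}"
      then show "0 \<le> \<tau> i" "\<tau> i \<le> \<tau> (Suc i)" "\<tau> (Suc i) \<le> T"
        using \<tau>(3)[of i] \<tau>(4)[of i] \<tau>(4)[of "Suc i"] t by auto
    qed
    also have "\<dots> = (\<Sum>i<N. R (q (\<tau> (Suc i)) - q (\<tau> i))) + (\<Sum>i<N. (V (\<tau> (Suc i)) - V (\<tau> i))\<^sup>2) / \<alpha>"
      by (simp add: sum.distrib sum_divide_distrib)
    also have "\<dots> \<le> (\<Sum>i<N. R (q (\<tau> (Suc i)) - q (\<tau> i))) + e"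
      using \<tau>(5) \<alpha>_pos by (simp add: field_simps)
    finally show ?thesis
      using \<tau>(1-3) by (intro exI[of _ N] exI[of _ \<tau>]) (auto simp: G_def J_def)
  qed
  show ?thesis
  proof (rule that[of q])
    show "norm (q t - q s) \<le> integral {s..t} (\<lambda>r. norm (l' r) / \<alpha>)" if "0 \<le> s" "s \<le> t" "t \<le> T" for s t
      using qlip[OF that] Vinc[OF that] by simp
  qed (use q0 qst qcont diss fine in \<open>auto simp: J_def\<close>)
qed

end

section \<open>The elastoplastic energy\<close>

lemma transpose_add: "transpose (a + b) = transpose a + transpose (b :: mat3)"
  by (simp add: transpose_def vec_eq_iff)

lemma transpose_scaleR: "transpose (r *\<^sub>R a) = r *\<^sub>R transpose (a :: mat3)"
  by (simp add: transpose_def vec_eq_iff)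

lemma subspace_Sym: "subspace Sym"
  by (auto simp: subspace_def Sym_def transpose_add transpose_scaleR) (simp add: transpose_def vec_eq_iff)

lemma trace_scaleR: "trace (r *\<^sub>R a) = r * trace (a :: mat3)"
  by (simp add: trace_def sum_distrib_left)

lemma subspace_Dev: "subspace Dev"
  using subspace_Sym by (simp add: subspace_def Dev_def trace_add trace_scaleR trace_scaleR[of 0 0, simplified])

lemma Dev_subset_Sym: "Dev \<subseteq> Sym"
  by (auto simp: Dev_def)

lemma ddot_commute: "ddot a b = ddot b a"
  unfolding ddot_def by (rule trace_mul_sym)

lemma ddot_eq_inner_right: "b \<in> Sym \<Longrightarrow> ddot a b = b \<bullet> a"
  unfolding ddot_commute[of a b] by (rule ddot_eq_inner)

text \<open>Composition with \<open>P\<close> extends maps that are constrained only on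
  \<open>Sym\<close> or \<open>Dev\<close> to well-behaved maps on the whole space; this is done for
  \<open>C\<close> and for \<open>D\<close>.\<close>

lemma subspace_projection:
  fixes S :: "'a::euclidean_space set"
  assumes "subspace S"
  obtains P where "linear P" "range P \<subseteq> S" "\<And>x. x \<in> S \<Longrightarrow> P x = x"
proof -
  obtain P where "range P \<subseteq> S" "linear P" "\<forall>x\<in>S. P (id x) = x"
    using linear_exists_left_inverse_on[OF linear_id assms inj_on_id] by blast
  then show ?thesis using that by simp
qed

text \<open>The two cases of \<rho> meet here: for \<rho> = 0 the constraint becomes the set
  \<open>Z\<close>, a ball in \<open>Dev\<close>, and for \<rho> > 0 \<open>Z\<close> is all of
  \<open>Dev\<close>. That \<open>Z\<close> contains 0 provides a competitor of finite
  energy.\<close>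

lemma hardening_domain:
  assumes c: "c1 > 0" "c2 > 0" "c3 > 0" and reg: "\<forall>r>0. regular_hardening c2 (Freg r)" and "\<rho> \<ge> 0"
  obtains Z f where "closed Z" "convex Z" "Z \<subseteq> Dev" "0 \<in> Z" "continuous_on Z f" "strongly_convex_on Z c2 f"
    "\<And>a. a \<in> Dev \<Longrightarrow> hardening c1 c2 c3 Freg \<rho> a = (if a \<in> Z then ereal (f a) else \<infinity>)"
proof (cases "\<rho> = 0")
  case True
  define Z where "Z = Dev \<inter> cball 0 c3"
  define f where "f a = c2 * (norm a)\<^sup>2 + c1 * norm a" for a :: mat3
  have "convex Z" unfolding Z_def using subspace_imp_convex[OF subspace_Dev] by (intro convex_Int) auto
  then have "convex_on Z (\<lambda>a. c1 * norm a)"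
    using c convex_on_dist[of Z 0] by (intro convex_on_cmul) (auto simp: dist_norm)
  then have "strongly_convex_on Z (2 * c2) f"
    unfolding f_def by (intro strongly_convex_on_add_convex strongly_convex_on_norm_power2)
  \<comment> \<open>The modulus \<open>2 * c2\<close> is lowered to \<open>c2\<close>, the one that
    the Hessian bound yields for \<rho> > 0.\<close>
  then have "strongly_convex_on Z c2 f" using c by (elim strongly_convex_on_mono) simp
  moreover have "closed Z" unfolding Z_def by (intro closed_Int closed_subspace[OF subspace_Dev] closed_cball)
  moreover have "continuous_on Z f" unfolding f_def by (intro continuous_intros)
  ultimately show ?thesis
    using True \<open>convex Z\<close> c
    by (intro that[of Z f]) (auto simp: Z_def f_def hardening_def F0_def subspace_0[OF subspace_Dev])
next
  case False
  then have "\<rho> > 0" using \<open>\<rho> \<ge> 0\<close> by simp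
  with reg have "regular_hardening c2 (Freg \<rho>)" by blast
  then obtain g H where
    g: "\<forall>a\<in>Dev. g a \<in> Dev \<and> (Freg \<rho> has_derivative (\<lambda>h. ddot (g a) h)) (at a within Dev)"
    and H: "\<forall>a\<in>Dev. H a ` Dev \<subseteq> Dev \<and> (g has_derivative H a) (at a within Dev)"
    and Hc: "\<forall>a\<in>Dev. \<forall>h\<in>Dev. ddot (H a h) h \<ge> c2 * (norm h)\<^sup>2"
    unfolding regular_hardening_def by - (elim conjE exE, rule that; assumption)
  have "(\<lambda>h. ddot (g a) h) = (\<lambda>h. g a \<bullet> h)" if "a \<in> Dev" for a
    using g that Dev_subset_Sym by (auto simp: ddot_eq_inner)
  then have f': "(Freg \<rho> has_derivative (\<lambda>h. g a \<bullet> h)) (at a within Dev)" if "a \<in> Dev" for a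
    using g that by simp
  have "strongly_convex_on Dev c2 (Freg \<rho>)"
  proof (rule second_derivative_strongly_convex[OF subspace_Dev f'])
    fix a h :: mat3 assume ah: "a \<in> Dev" "h \<in> Dev"
    then have "H a h \<in> Sym" using H Dev_subset_Sym by blast
    then show "c2 * (norm h)\<^sup>2 \<le> H a h \<bullet> h"
      using Hc ah ddot_eq_inner[of "H a h" h] by metis
  qed (use H in auto)
  moreover have "continuous_on Dev (Freg \<rho>)"
    unfolding continuous_on_eq_continuous_within using has_derivative_continuous[OF f'] by blast
  ultimately show ?thesis
    using False by (intro that[of Dev "Freg \<rho>"])
      (auto simp: hardening_def subspace_0[OF subspace_Dev]
        intro: closed_subspace subspace_Dev subspace_imp_convex)
qed

text \<open>The constant is the minimum of the quadratic form over the compact unit sphere of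
  \<open>Sym\<close>, extended by homogeneity; the last identity is the exact convexity defect of a
  quadratic form.\<close>

lemma elastic_energy:
  assumes "elasticity_tensor C"
  obtains c where "c > 0" "continuous_on Sym (\<lambda>x. ddot (C x) x)"
    "\<And>x. x \<in> Sym \<Longrightarrow> ddot (C x) x \<ge> c * (norm x)\<^sup>2"
    "\<And>x y \<theta>. x \<in> Sym \<Longrightarrow> y \<in> Sym \<Longrightarrow> ddot (C ((1 - \<theta>) *\<^sub>R x + \<theta> *\<^sub>R y)) ((1 - \<theta>) *\<^sub>R x + \<theta> *\<^sub>R y)
       = (1 - \<theta>) * ddot (C x) x + \<theta> * ddot (C y) y - \<theta> * (1 - \<theta>) * ddot (C (x - y)) (x - y)"
proof -
  have CS: "\<And>a. a \<in> Sym \<Longrightarrow> C a \<in> Sym"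
    and Cadd: "\<And>a b. a \<in> Sym \<Longrightarrow> b \<in> Sym \<Longrightarrow> C (a + b) = C a + C b"
    and Cscale: "\<And>r a. a \<in> Sym \<Longrightarrow> C (r *\<^sub>R a) = r *\<^sub>R C a"
    and Csym: "\<And>a b. a \<in> Sym \<Longrightarrow> b \<in> Sym \<Longrightarrow> ddot (C a) b = ddot a (C b)"
    and Cpos: "\<And>a. a \<in> Sym \<Longrightarrow> a \<noteq> 0 \<Longrightarrow> ddot (C a) a > 0"
    using assms by (auto simp: elasticity_tensor_def)
  have dd: "ddot (C x) x = C x \<bullet> x" if "x \<in> Sym" for x using ddot_eq_inner CS[OF that] by blast
  note S = subspace_add[OF subspace_Sym] subspace_scale[OF subspace_Sym] subspace_diff[OF subspace_Sym]
  obtain P where P: "linear P" "range P \<subseteq> Sym" "\<And>x. x \<in> Sym \<Longrightarrow> P x = x"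
    using subspace_projection[OF subspace_Sym] by blast
  have PS: "P x \<in> Sym" for x using P(2) by auto
  \<comment> \<open>\<open>C\<close> is linear on \<open>Sym\<close> only; precomposed with
    \<open>P\<close> it is linear everywhere, hence continuous, and unchanged on
    \<open>Sym\<close>.\<close>
  have "linear (\<lambda>x. C (P x))"
    using P(1) PS by (intro linearI) (auto simp: linear_add linear_scale Cadd Cscale)
  then have "continuous_on Sym (\<lambda>x. C (P x) \<bullet> x)"
    by (intro continuous_intros linear_continuous_on linear_conv_bounded_linear[THEN iffD1])
  then have cont: "continuous_on Sym (\<lambda>x. ddot (C x) x)"
    by (rule continuous_on_eq) (simp add: P(3) dd)
  have "\<exists>c>0. \<forall>x\<in>Sym. norm x = 1 \<longrightarrow> ddot (C x) x \<ge> c"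
  proof (cases "Sym \<inter> sphere 0 1 = {}")
    case True
    then show ?thesis by (intro exI[of _ 1]) auto
  next
    case False
    have "compact (Sym \<inter> sphere 0 1)" by (intro closed_Int_compact closed_subspace[OF subspace_Sym] compact_sphere)
    then obtain m where m: "m \<in> Sym \<inter> sphere 0 1" "\<And>x. x \<in> Sym \<inter> sphere 0 1 \<Longrightarrow> ddot (C m) m \<le> ddot (C x) x"
      using continuous_attains_inf[OF _ False continuous_on_subset[OF cont Int_lower1]] by blast
    have "ddot (C m) m > 0" using m(1) Cpos[of m] by (cases "m = 0") auto
    then show ?thesis using m(2) by (intro exI[of _ "ddot (C m) m"]) auto
  qed
  then obtain c where c: "c > 0" "\<And>x. x \<in> Sym \<Longrightarrow> norm x = 1 \<Longrightarrow> ddot (C x) x \<ge> c" by blast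
  have lower: "ddot (C x) x \<ge> c * (norm x)\<^sup>2" if x: "x \<in> Sym" for x
  proof (cases "x = 0")
    case True
    then show ?thesis using dd[OF x] by simp
  next
    case False
    define y where "y = (1 / norm x) *\<^sub>R x"
    have y: "y \<in> Sym" "norm y = 1" using x False S by (auto simp: y_def)
    have yx: "norm x *\<^sub>R y = x" using False by (simp add: y_def)
    have "ddot (C (r *\<^sub>R y)) (r *\<^sub>R y) = r\<^sup>2 * ddot (C y) y" for r
      using dd[OF y(1)] dd[OF S(2)[OF y(1)]] Cscale[OF y(1)] by (simp add: power2_eq_square)
    from this[of "norm x"] have "ddot (C x) x = (norm x)\<^sup>2 * ddot (C y) y" unfolding yx .
    then show ?thesis using c(2)[OF y] by (simp add: mult.commute mult_right_mono)
  qed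
  have quad: "ddot (C ((1 - \<theta>) *\<^sub>R x + \<theta> *\<^sub>R y)) ((1 - \<theta>) *\<^sub>R x + \<theta> *\<^sub>R y)
       = (1 - \<theta>) * ddot (C x) x + \<theta> * ddot (C y) y - \<theta> * (1 - \<theta>) * ddot (C (x - y)) (x - y)"
    if x: "x \<in> Sym" and y: "y \<in> Sym" for x y \<theta>
  proof -
    have 1: "C ((1 - \<theta>) *\<^sub>R x + \<theta> *\<^sub>R y) = (1 - \<theta>) *\<^sub>R C x + \<theta> *\<^sub>R C y"
      using x y by (simp add: Cadd Cscale S)
    have 2: "C (x - y) = C x - C y"
      using Cadd[of x "(-1) *\<^sub>R y"] Cscale[OF y, of "-1"] x y S(2)[OF y, of "-1"] by simp
    have 3: "C y \<bullet> x = C x \<bullet> y"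
      using Csym[OF y x] by (simp add: ddot_eq_inner CS x y inner_commute)
    have "((1 - \<theta>) *\<^sub>R C x + \<theta> *\<^sub>R C y) \<bullet> ((1 - \<theta>) *\<^sub>R x + \<theta> *\<^sub>R y)
      = (1 - \<theta>) * (C x \<bullet> x) + \<theta> * (C y \<bullet> y) - \<theta> * (1 - \<theta>) * ((C x - C y) \<bullet> (x - y))"
      using 3 by (simp add: inner_add_left inner_add_right inner_diff_left inner_diff_right algebra_simps)
    then show ?thesis
      unfolding dd[OF x] dd[OF y] dd[OF S(1)[OF S(2)[OF x] S(2)[OF y]]] dd[OF S(3)[OF x y]]
      unfolding 1 2 .
  qed
  show ?thesis by (rule that[of c]) (use c cont lower quad in auto)
qed

text \<open>\<open>Q\<close> sees only the difference a - b of the two components and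
  \<open>f\<close> only b. As |a|^2 is at most 2|a - b|^2 + 2|b|^2, the squared norm of (a, b) is at
  most 3 (|a - b|^2 + |b|^2); this is the origin of the factor 1/3.\<close>

lemma elastoplastic_energy_strongly_convex:
  assumes quad: "\<And>x y \<theta>. x \<in> Sym \<Longrightarrow> y \<in> Sym \<Longrightarrow> Q ((1 - \<theta>) *\<^sub>R x + \<theta> *\<^sub>R y)
       = (1 - \<theta>) * Q x + \<theta> * Q y - \<theta> * (1 - \<theta>) * Q (x - y)"
    and lower: "\<And>x. x \<in> Sym \<Longrightarrow> Q x \<ge> c * (norm x)\<^sup>2"
    and f: "strongly_convex_on Z c2 f" and Z: "Z \<subseteq> Sym" and "c > 0" "c2 > 0"
  shows "strongly_convex_on (Sym \<times> Z) (min c c2 / 3) (\<lambda>q. 1/2 * Q (fst q - snd q) + f (snd q))"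
  unfolding strongly_convex_on_def
proof (intro ballI)
  fix p q and \<theta> :: real assume p: "p \<in> Sym \<times> Z" and q: "q \<in> Sym \<times> Z" and \<theta>: "\<theta> \<in> {0..1}"
  define m where "m = min c c2"
  have m: "m > 0" "m \<le> c" "m \<le> c2" using assms by (auto simp: m_def)
  have S: "fst p - snd p \<in> Sym" "fst q - snd q \<in> Sym"
    using p q Z by (auto intro!: subspace_diff[OF subspace_Sym])
  define a where "a = fst p - fst q"
  define b where "b = snd p - snd q"
  have ab: "(fst p - snd p) - (fst q - snd q) = a - b" by (simp add: a_def b_def)
  have "a - b \<in> Sym" unfolding ab[symmetric] by (rule subspace_diff[OF subspace_Sym S])
  have "(norm a)\<^sup>2 \<le> 2 * (norm (a - b))\<^sup>2 + 2 * (norm b)\<^sup>2"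
  proof -
    have "norm a \<le> norm (a - b) + norm b" using norm_triangle_ineq[of "a - b" b] by simp
    then have "(norm a)\<^sup>2 \<le> (norm (a - b) + norm b)\<^sup>2" by (intro power_mono) auto
    also have "\<dots> \<le> 2 * (norm (a - b))\<^sup>2 + 2 * (norm b)\<^sup>2"
      using sum_squares_bound[of "norm (a - b)" "norm b"] by (simp add: power2_sum)
    finally show ?thesis .
  qed
  moreover have "(norm (p - q))\<^sup>2 = (norm a)\<^sup>2 + (norm b)\<^sup>2"
    by (simp add: a_def b_def norm_prod_def)
  ultimately have "(norm (p - q))\<^sup>2 \<le> 3 * ((norm (a - b))\<^sup>2 + (norm b)\<^sup>2)"
    using zero_le_power2[of "norm (a - b)"] by argo
  then have "m / 3 * (norm (p - q))\<^sup>2 \<le> m / 3 * (3 * ((norm (a - b))\<^sup>2 + (norm b)\<^sup>2))"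
    using m by (intro mult_left_mono) auto
  also have "\<dots> = m * (norm (a - b))\<^sup>2 + m * (norm b)\<^sup>2" by (simp add: algebra_simps)
  also have "\<dots> \<le> c * (norm (a - b))\<^sup>2 + c2 * (norm b)\<^sup>2"
    using m by (intro add_mono mult_right_mono) auto
  also have "\<dots> \<le> Q (a - b) + c2 * (norm b)\<^sup>2" using lower[OF \<open>a - b \<in> Sym\<close>] by simp
  finally have gap: "m / 3 * (norm (p - q))\<^sup>2 \<le> Q (a - b) + c2 * (norm b)\<^sup>2" .
  define k where "k = \<theta> * (1 - \<theta>) / 2"
  have comb: "fst ((1 - \<theta>) *\<^sub>R p + \<theta> *\<^sub>R q) - snd ((1 - \<theta>) *\<^sub>R p + \<theta> *\<^sub>R q)
      = (1 - \<theta>) *\<^sub>R (fst p - snd p) + \<theta> *\<^sub>R (fst q - snd q)"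
    by (simp add: algebra_simps)
  have "k \<ge> 0" using \<theta> by (simp add: k_def)
  then have "k * (m / 3 * (norm (p - q))\<^sup>2) \<le> k * Q (a - b) + k * (c2 * (norm b)\<^sup>2)"
    using mult_left_mono[OF gap] by (simp add: distrib_left)
  moreover have "1/2 * Q ((1 - \<theta>) *\<^sub>R (fst p - snd p) + \<theta> *\<^sub>R (fst q - snd q))
       = (1 - \<theta>) * (1/2 * Q (fst p - snd p)) + \<theta> * (1/2 * Q (fst q - snd q)) - k * Q (a - b)"
  proof -
    have "1/2 * ((1 - \<theta>) * A + \<theta> * B - \<theta> * (1 - \<theta>) * E) = (1 - \<theta>) * (1/2 * A) + \<theta> * (1/2 * B) - k * E" for A B E
      by (simp add: k_def field_simps)
    then show ?thesis using quad[OF S, of \<theta>] unfolding ab by metis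
  qed
  moreover have "f (snd ((1 - \<theta>) *\<^sub>R p + \<theta> *\<^sub>R q))
      \<le> (1 - \<theta>) * f (snd p) + \<theta> * f (snd q) - k * (c2 * (norm b)\<^sup>2)"
    using strongly_convex_onD[OF f, of "snd p" "snd q" \<theta>] p q \<theta> by (auto simp: b_def k_def mult_ac)
  ultimately have "1/2 * Q (fst ((1 - \<theta>) *\<^sub>R p + \<theta> *\<^sub>R q) - snd ((1 - \<theta>) *\<^sub>R p + \<theta> *\<^sub>R q))
       + f (snd ((1 - \<theta>) *\<^sub>R p + \<theta> *\<^sub>R q))
    \<le> (1 - \<theta>) * (1/2 * Q (fst p - snd p)) + (1 - \<theta>) * f (snd p) + (\<theta> * (1/2 * Q (fst q - snd q)) + \<theta> * f (snd q))
      - k * (m / 3 * (norm (p - q))\<^sup>2)"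
    unfolding comb by linarith
  moreover have "k * (m / 3 * (norm (p - q))\<^sup>2) = min c c2 / 3 / 2 * \<theta> * (1 - \<theta>) * (norm (p - q))\<^sup>2"
    by (simp add: k_def m_def)
  ultimately show "1/2 * Q (fst ((1 - \<theta>) *\<^sub>R p + \<theta> *\<^sub>R q) - snd ((1 - \<theta>) *\<^sub>R p + \<theta> *\<^sub>R q))
       + f (snd ((1 - \<theta>) *\<^sub>R p + \<theta> *\<^sub>R q))
    \<le> (1 - \<theta>) * (1/2 * Q (fst p - snd p) + f (snd p)) + \<theta> * (1/2 * Q (fst q - snd q) + f (snd q))
      - min c c2 / 3 / 2 * \<theta> * (1 - \<theta>) * (norm (p - q))\<^sup>2"
    unfolding distrib_left by linarith
qed

text \<open>Increments dominated by the decrease of \<open>G\<close> telescope, which bounds every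
  partition sum from above; \<open>low\<close> supplies partitions that nearly attain this
  bound.\<close>

lemma Diss_eqI:
  assumes up: "\<And>s t'. 0 \<le> s \<Longrightarrow> s \<le> t' \<Longrightarrow> t' \<le> t \<Longrightarrow> D (z t' - z s) \<le> G s - G t'"
    and low: "\<And>e. e > 0 \<Longrightarrow> \<exists>(N::nat) \<tau>. \<tau> 0 = 0 \<and> \<tau> N = t \<and> (\<forall>i<N. \<tau> i < \<tau> (Suc i)) \<and>
       G 0 - G t \<le> (\<Sum>i<N. D (z (\<tau> (Suc i)) - z (\<tau> i))) + e"
  shows "Diss D z 0 t = ereal (G 0 - G t)"
proof (rule antisym)
  have sums: "(\<Sum>i=1..N. D (z (\<tau> i) - z (\<tau> (i - 1)))) = (\<Sum>i<N. D (z (\<tau> (Suc i)) - z (\<tau> i)))"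
    for N and \<tau> :: "nat \<Rightarrow> real"
    using sum.atLeast1_atMost_eq[of "\<lambda>i. D (z (\<tau> i) - z (\<tau> (i - 1)))" N] by simp
  show "Diss D z 0 t \<le> ereal (G 0 - G t)"
    unfolding Diss_def
  proof (intro SUP_least, clarify)
    fix N and \<tau> :: "nat \<Rightarrow> real"
    assume \<tau>: "\<tau> 0 = 0" "t = \<tau> N" "\<forall>i<N. \<tau> i < \<tau> (Suc i)"
    have mono: "\<tau> i \<le> \<tau> j" if "i \<le> j" "j \<le> N" for i j
      using that
    proof (induction j rule: dec_induct)
      case (step j)
      then show ?case using \<tau>(3)[rule_format, of j] by simp
    qed simp
    have "(\<Sum>i<N. D (z (\<tau> (Suc i)) - z (\<tau> i))) \<le> (\<Sum>i<N. G (\<tau> i) - G (\<tau> (Suc i)))"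
    proof (intro sum_mono up)
      fix i assume "i \<in> {..<N}"
      then show "0 \<le> \<tau> i" "\<tau> i \<le> \<tau> (Suc i)" "\<tau> (Suc i) \<le> t"
        using mono[of 0 i] mono[of i "Suc i"] mono[of "Suc i" N] \<tau>(1,2) by auto
    qed
    also have "\<dots> = G 0 - G (\<tau> N)" by (subst sum_lessThan_telescope') (simp add: \<tau>)
    finally show "ereal (\<Sum>i=1..N. D (z (\<tau> i) - z (\<tau> (i - 1)))) \<le> ereal (G 0 - G (\<tau> N))"
      by (simp only: sums ereal_less_eq)
  qed
  show "ereal (G 0 - G t) \<le> Diss D z 0 t"
  proof (rule ereal_le_epsilon2)
    fix e :: real assume "0 < e"
    then obtain N :: nat and \<tau> where \<tau>: "\<tau> 0 = 0" "\<tau> N = t" "\<forall>i<N. \<tau> i < \<tau> (Suc i)"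
      and le: "G 0 - G t \<le> (\<Sum>i<N. D (z (\<tau> (Suc i)) - z (\<tau> i))) + e"
      using low by blast
    have "ereal (\<Sum>i=1..N. D (z (\<tau> i) - z (\<tau> (i - 1)))) \<le> Diss D z 0 t"
      unfolding Diss_def by (rule SUP_upper2[of "(N, \<tau>)"]) (use \<tau> in auto)
    moreover have "ereal (G 0 - G t) \<le> ereal (\<Sum>i<N. D (z (\<tau> (Suc i)) - z (\<tau> i))) + ereal e"
      using le by simp
    ultimately show "ereal (G 0 - G t) \<le> Diss D z 0 t + ereal e"
      unfolding sums by (meson add_right_mono order_trans)
  qed
qed

text \<open>The pair \<open>(\<epsilon>, z)\<close> evolves in \<open>Sym \<times> Dev\<close> under the load \<open>(\<sigma>, 0)\<close>.\<close>

theorem theorem3p2: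
  fixes C :: "mat3 \<Rightarrow> mat3" and D :: "mat3 \<Rightarrow> real"
    and c1 c2 c3 \<rho> T :: real and Freg :: "real \<Rightarrow> mat3 \<Rightarrow> real"
    and \<sigma> \<sigma>' :: "real \<Rightarrow> mat3" and \<epsilon>0 z0 :: mat3
  defines "W \<equiv> stored_energy C (hardening c1 c2 c3 Freg \<rho>)"
  assumes "elasticity_tensor C"
    and "c1 > 0" and "c2 > 0" and "c3 > 0"
    and "\<forall>r>0. regular_hardening c2 (Freg r)"
    and "dissipation_potential D"
    and "\<rho> \<ge> 0"
    and "T > 0"
    and "\<sigma> \<in> W11 T Sym" and "weak_derivative T \<sigma> \<sigma>'"
    and "(\<epsilon>0, z0) \<in> stable_states W D \<sigma> 0"
  shows "\<exists>\<epsilon> z. energetic_solution T W D \<sigma> \<sigma>' \<epsilon> z \<and>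
           (\<epsilon> 0, z 0) = (\<epsilon>0, z0) \<and>
           (\<lambda>t. (\<epsilon> t, z t)) \<in> W11 T (Sym \<times> Dev)"
proof -
  have D_scale: "\<And>r a. r > 0 \<Longrightarrow> a \<in> Dev \<Longrightarrow> D (r *\<^sub>R a) = r * D a"
    and D_tri: "\<And>a b. a \<in> Dev \<Longrightarrow> b \<in> Dev \<Longrightarrow> D (a + b) \<le> D a + D b"
    using \<open>dissipation_potential D\<close> by (auto simp: dissipation_potential_def)
  obtain Z f where Z: "closed Z" "convex Z" "Z \<subseteq> Dev" "0 \<in> Z" and f: "continuous_on Z f" "strongly_convex_on Z c2 f"
    and hard: "\<And>a. a \<in> Dev \<Longrightarrow> hardening c1 c2 c3 Freg \<rho> a = (if a \<in> Z then ereal (f a) else \<infinity>)"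
    using hardening_domain[OF \<open>c1 > 0\<close> \<open>c2 > 0\<close> \<open>c3 > 0\<close> \<open>\<forall>r>0. regular_hardening c2 (Freg r)\<close> \<open>\<rho> \<ge> 0\<close>] by blast
  obtain c where c: "c > 0" and Qcont: "continuous_on Sym (\<lambda>x. ddot (C x) x)"
    and Qlow: "\<And>x. x \<in> Sym \<Longrightarrow> ddot (C x) x \<ge> c * (norm x)\<^sup>2"
    and Qquad: "\<And>x y \<theta>. x \<in> Sym \<Longrightarrow> y \<in> Sym \<Longrightarrow> ddot (C ((1 - \<theta>) *\<^sub>R x + \<theta> *\<^sub>R y)) ((1 - \<theta>) *\<^sub>R x + \<theta> *\<^sub>R y)
       = (1 - \<theta>) * ddot (C x) x + \<theta> * ddot (C y) y - \<theta> * (1 - \<theta>) * ddot (C (x - y)) (x - y)"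
    using elastic_energy[OF \<open>elasticity_tensor C\<close>] by blast
  obtain P where P: "linear P" "range P \<subseteq> Dev" "\<And>x. x \<in> Dev \<Longrightarrow> P x = x"
    using subspace_projection[OF subspace_Dev] by blast
  have PDev: "P x \<in> Dev" for x using P(2) by auto
  have ZSym: "Z \<subseteq> Sym" using Z(3) Dev_subset_Sym by blast
  define \<Phi> where "\<Phi> q = 1/2 * ddot (C (fst q - snd q)) (fst q - snd q) + f (snd q)" for q :: "mat3 \<times> mat3"
  \<comment> \<open>\<open>D\<close> is constrained on \<open>Dev\<close> only; through
    \<open>P\<close> the dissipation becomes sublinear on all pairs and agrees with \<open>D\<close>
    on differences of states.\<close>
  define R where "R q = D (P (snd q))" for q :: "mat3 \<times> mat3"
  define K where "K = Sym \<times> Z"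
  have K_iff: "(e, z) \<in> K \<longleftrightarrow> e \<in> Sym \<and> z \<in> Z" for e z by (simp add: K_def)
  interpret rate_independent_system K \<Phi> R "min c c2 / 3"
  proof
    show "closed K" unfolding K_def by (intro closed_Times closed_subspace[OF subspace_Sym] Z)
    show "convex K" unfolding K_def by (intro convex_Times subspace_imp_convex[OF subspace_Sym] Z)
    have "continuous_on K (\<lambda>q. ddot (C (fst q - snd q)) (fst q - snd q))"
    proof (rule continuous_on_compose2[OF Qcont])
      show "continuous_on K (\<lambda>q. fst q - snd q)" by (intro continuous_intros)
      show "(\<lambda>q. fst q - snd q) ` K \<subseteq> Sym"
        using ZSym by (auto simp: K_def intro!: subspace_diff[OF subspace_Sym])
    qed
    moreover have "continuous_on K (\<lambda>q. f (snd q))"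
      by (rule continuous_on_compose2[OF f(1)]) (auto simp: K_def intro!: continuous_intros)
    ultimately show "continuous_on K \<Phi>" unfolding \<Phi>_def by (intro continuous_intros)
    show "min c c2 / 3 > 0" using c \<open>c2 > 0\<close> by simp
    show "strongly_convex_on K (min c c2 / 3) \<Phi>"
      unfolding K_def \<Phi>_def
      by (rule elastoplastic_energy_strongly_convex[where Q = "\<lambda>x. ddot (C x) x"])
         (use Qquad Qlow f(2) ZSym c \<open>c2 > 0\<close> in auto)
    show "R (r *\<^sub>R q) = r * R q" if "r > 0" for r q
      unfolding R_def using that by (simp add: linear_scale[OF P(1)] D_scale PDev)
    show "R (p + q) \<le> R p + R q" for p q
      unfolding R_def by (simp add: linear_add[OF P(1)] D_tri PDev)
  qed
  have \<sigma>_cont: "continuous_on {0..T} \<sigma>" and \<sigma>_Sym: "\<And>t. t \<in> {0..T} \<Longrightarrow> \<sigma> t \<in> Sym"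
    using \<open>\<sigma> \<in> W11 T Sym\<close> by (auto simp: W11_def)
  have \<sigma>': "\<sigma>' absolutely_integrable_on {0..T}"
    using \<open>weak_derivative T \<sigma> \<sigma>'\<close> by (simp add: weak_derivative_def absolutely_integrable_on_Icc_iff_Ioo)
  define l where "l t = (\<sigma> t, 0 :: mat3)" for t
  define l' where "l' t = (\<sigma>' t, 0 :: mat3)" for t
  have pair: "bounded_linear (\<lambda>x :: mat3. (x, 0 :: mat3))"
    by (intro bounded_linear_Pair bounded_linear_ident bounded_linear_zero)
  have l': "l' absolutely_integrable_on {0..T}"
    using absolutely_integrable_linear[OF \<sigma>' pair] by (simp add: l'_def[abs_def] o_def)
  have l: "l t - l s = integral {s..t} l'" if st: "0 \<le> s" "s \<le> t" "t \<le> T" for s t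
  proof -
    have "\<sigma>' integrable_on {s..t}"
      using \<sigma>' st by (auto simp: absolutely_integrable_on_def intro: integrable_on_subinterval)
    from integral_linear[OF this pair]
    have "integral {s..t} l' = (integral {s..t} \<sigma>', 0)" by (simp add: l'_def[abs_def] o_def)
    then show ?thesis
      using weak_derivative_imp_integral[OF \<open>T > 0\<close> \<open>weak_derivative T \<sigma> \<sigma>'\<close> \<sigma>_cont st] by (simp add: l_def)
  qed
  have W: "W e z = (if z \<in> Z then ereal (\<Phi> (e, z)) else \<infinity>)" if "z \<in> Dev" for e z
    using hard[OF that] by (simp add: W_def stored_energy_def \<Phi>_def)
  have load: "ddot (\<sigma> t) e = l t \<bullet> (e, z)" if "t \<in> {0..T}" for t e z
    using ddot_eq_inner[OF \<sigma>_Sym[OF that]] by (simp add: l_def inner_prod_def)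
  have R_diff: "R ((e', z') - (e, z)) = D (z' - z)" if "z \<in> Dev" "z' \<in> Dev" for e e' z z'
    using P(3)[OF subspace_diff[OF subspace_Dev that(2,1)]] by (simp add: R_def)
  have stable_iff: "(e, z) \<in> stable_states W D \<sigma> t \<longleftrightarrow> (e, z) \<in> stable (l t)" if t: "t \<in> {0..T}" for e z t
  proof
    assume st: "(e, z) \<in> stable_states W D \<sigma> t"
    then have ez: "e \<in> Sym" "z \<in> Dev" by (auto simp: stable_states_def)
    have le: "W e z - ereal (ddot (\<sigma> t) e) \<le> W e' z' - ereal (ddot (\<sigma> t) e') + ereal (D (z' - z))"
      if "e' \<in> Sym" "z' \<in> Dev" for e' z'
      using st that by (auto simp: stable_states_def)
    \<comment> \<open>The competitor (0, 0) has finite energy, whereas the energy of a state with z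
      outside \<open>Z\<close> is infinite; stability excludes this.\<close>
    have "z \<in> Z"
      using le[of 0 0] Z(3,4) ez(2) by (cases "z \<in> Z") (auto simp: W subspace_0[OF subspace_Sym])
    moreover have "\<Phi> (e, z) - l t \<bullet> (e, z) \<le> \<Phi> y - l t \<bullet> y + R (y - (e, z))" if "y \<in> K" for y
    proof -
      obtain e' z' where y: "y = (e', z')" by (cases y)
      then have "e' \<in> Sym" "z' \<in> Z" "z' \<in> Dev" using that Z(3) by (auto simp: K_def)
      then show ?thesis
        using le[of e' z'] \<open>z \<in> Z\<close> ez R_diff[of z z' e' e] load[OF t, of e z] load[OF t, of e' z'] by (simp add: y W)
    qed
    ultimately show "(e, z) \<in> stable (l t)" using ez by (auto simp: stable_def K_iff)
  next
    assume st: "(e, z) \<in> stable (l t)"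
    then have ez: "e \<in> Sym" "z \<in> Z" "z \<in> Dev" using Z(3) by (auto simp: stable_def K_iff)
    have "W e z - ereal (ddot (\<sigma> t) e) \<le> W e' z' - ereal (ddot (\<sigma> t) e') + ereal (D (z' - z))"
      if "e' \<in> Sym" "z' \<in> Dev" for e' z'
    proof (cases "z' \<in> Z")
      case True
      then have "\<Phi> (e, z) - l t \<bullet> (e, z) \<le> \<Phi> (e', z') - l t \<bullet> (e', z') + R ((e', z') - (e, z))"
        using st that K_iff[of e' z'] unfolding stable_def by blast
      then show ?thesis
        using True ez that R_diff[of z z' e' e] load[OF t, of e z] load[OF t, of e' z'] by (simp add: W)
    qed (simp add: W that)
    then show "(e, z) \<in> stable_states W D \<sigma> t" using ez by (auto simp: stable_states_def)
  qed
  have stable0: "(\<epsilon>0, z0) \<in> stable (l 0)"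
    using stable_iff[of 0] \<open>(\<epsilon>0, z0) \<in> stable_states W D \<sigma> 0\<close> \<open>T > 0\<close> by simp
  obtain q where q0: "q 0 = (\<epsilon>0, z0)" and qst: "\<And>t. t \<in> {0..T} \<Longrightarrow> q t \<in> stable (l t)"
    and qcont: "continuous_on {0..T} q"
    and qlip: "\<And>s t. 0 \<le> s \<Longrightarrow> s \<le> t \<Longrightarrow> t \<le> T \<Longrightarrow>
       norm (q t - q s) \<le> integral {s..t} (\<lambda>r. norm (l' r) / (min c c2 / 3))"
    and qdis: "\<And>s t. 0 \<le> s \<Longrightarrow> s \<le> t \<Longrightarrow> t \<le> T \<Longrightarrow>
       \<Phi> (q t) - l t \<bullet> q t + integral {s..t} (\<lambda>r. q r \<bullet> l' r) + R (q t - q s) \<le> \<Phi> (q s) - l s \<bullet> q s"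
    and qfine: "\<And>t e. t \<in> {0..T} \<Longrightarrow> e > 0 \<Longrightarrow> \<exists>(N::nat) \<tau>. \<tau> 0 = 0 \<and> \<tau> N = t \<and> (\<forall>i<N. \<tau> i < \<tau> (Suc i)) \<and>
       \<Phi> (q 0) - l 0 \<bullet> q 0 \<le> \<Phi> (q t) - l t \<bullet> q t + integral {0..t} (\<lambda>r. q r \<bullet> l' r)
         + (\<Sum>i<N. R (q (\<tau> (Suc i)) - q (\<tau> i))) + e"
    by (rule energetic_evolution[where l = l, OF \<open>T > 0\<close> stable0 l']) (rule l that; assumption)+
  define \<epsilon> where "\<epsilon> t = fst (q t)" for t
  define z where "z t = snd (q t)" for t
  have q: "q t = (\<epsilon> t, z t)" for t by (simp add: \<epsilon>_def z_def)
  have \<epsilon>z: "\<epsilon> t \<in> Sym" "z t \<in> Z" "z t \<in> Dev" if "t \<in> {0..T}" for t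
    using qst[OF that] Z(3) unfolding q by (auto simp: stable_def K_iff)
  \<comment> \<open>\<open>\<sigma>'\<close> is an arbitrary version of the weak derivative and its
    values need not be symmetric; the symmetry of \<open>\<epsilon> t\<close> identifies
    \<open>ddot\<close> with the inner product.\<close>
  have power: "ddot (\<sigma>' t) (\<epsilon> t) = q t \<bullet> l' t" if "t \<in> {0..T}" for t
    using ddot_eq_inner_right[OF \<epsilon>z(1)[OF that]] by (simp add: q l'_def)
  have qli: "(\<lambda>t. q t \<bullet> l' t) absolutely_integrable_on {0..T}"
    by (rule absolutely_integrable_continuous_inner[OF qcont l'])
  then have pint: "(\<lambda>t. ddot (\<sigma>' t) (\<epsilon> t)) absolutely_integrable_on {0..T}"
    using power by (subst set_integrable_cong[OF refl]) auto
  have qli': "(\<lambda>t. q t \<bullet> l' t) integrable_on {0..T}" using qli by (simp add: absolutely_integrable_on_def)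
  have LINT: "(LINT s:{0..t}|lebesgue. ddot (\<sigma>' s) (\<epsilon> s)) = integral {0..t} (\<lambda>r. q r \<bullet> l' r)" if "t \<in> {0..T}" for t
  proof -
    have "(\<lambda>s. ddot (\<sigma>' s) (\<epsilon> s)) absolutely_integrable_on {0..t}"
      using pint that by (auto intro: absolutely_integrable_on_subinterval)
    then have "(LINT s:{0..t}|lebesgue. ddot (\<sigma>' s) (\<epsilon> s)) = integral {0..t} (\<lambda>s. ddot (\<sigma>' s) (\<epsilon> s))"
      by (rule set_lebesgue_integral_eq_integral(2))
    also have "\<dots> = integral {0..t} (\<lambda>r. q r \<bullet> l' r)"
      using that by (intro integral_cong power) auto
    finally show ?thesis .
  qed
  \<comment> \<open>Energy plus accumulated work: its total decrease is the dissipation, which is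
    the energy balance.\<close>
  define G where "G t = \<Phi> (q t) - l t \<bullet> q t + integral {0..t} (\<lambda>r. q r \<bullet> l' r)" for t
  have Rq: "R (q t - q s) = D (z t - z s)" if "s \<in> {0..T}" "t \<in> {0..T}" for s t
    unfolding q using \<epsilon>z(3)[OF that(1)] \<epsilon>z(3)[OF that(2)] by (rule R_diff)
  have Diss: "Diss D z 0 t = ereal (G 0 - G t)" if t: "t \<in> {0..T}" for t
  proof (rule Diss_eqI)
    fix s t' assume st: "0 \<le> s" "s \<le> t'" "t' \<le> t"
    then have "t' \<le> T" using t by simp
    then show "D (z t' - z s) \<le> G s - G t'"
      using qdis[OF st(1,2)] integral_increment[OF qli' st(1,2)] Rq[of s t'] st t by (simp add: G_def)
  next
    fix e :: real assume "e > 0"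
    then obtain N :: nat and \<tau> where \<tau>: "\<tau> 0 = 0" "\<tau> N = t" "\<forall>i<N. \<tau> i < \<tau> (Suc i)"
      and le: "\<Phi> (q 0) - l 0 \<bullet> q 0 \<le> \<Phi> (q t) - l t \<bullet> q t + integral {0..t} (\<lambda>r. q r \<bullet> l' r)
         + (\<Sum>i<N. R (q (\<tau> (Suc i)) - q (\<tau> i))) + e"
      using qfine[OF t] by blast
    have mono: "\<tau> i \<le> \<tau> j" if "i \<le> j" "j \<le> N" for i j
      using that
    proof (induction j rule: dec_induct)
      case (step j)
      then show ?case using \<tau>(3)[rule_format, of j] by simp
    qed simp
    have "\<tau> i \<in> {0..T}" if "i \<le> N" for i
      using mono[of 0 i] mono[of i N] \<tau> that t by auto
    then have "(\<Sum>i<N. R (q (\<tau> (Suc i)) - q (\<tau> i))) = (\<Sum>i<N. D (z (\<tau> (Suc i)) - z (\<tau> i)))"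
      by (intro sum.cong Rq) auto
    then show "\<exists>(N::nat) \<tau>. \<tau> 0 = 0 \<and> \<tau> N = t \<and> (\<forall>i<N. \<tau> i < \<tau> (Suc i)) \<and>
       G 0 - G t \<le> (\<Sum>i<N. D (z (\<tau> (Suc i)) - z (\<tau> i))) + e"
      using \<tau> le by (intro exI[of _ N] exI[of _ \<tau>]) (simp add: G_def)
  qed
  have energy: "W (\<epsilon> t) (z t) - ereal (ddot (\<sigma> t) (\<epsilon> t)) = ereal (\<Phi> (q t) - l t \<bullet> q t)" if "t \<in> {0..T}" for t
    using \<epsilon>z[OF that] load[OF that, of "\<epsilon> t" "z t"] by (simp add: W q)
  have "energetic_solution T W D \<sigma> \<sigma>' \<epsilon> z"
    unfolding energetic_solution_def
  proof (intro conjI ballI pint)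
    fix t assume t: "t \<in> {0..T}"
    show "(\<epsilon> t, z t) \<in> stable_states W D \<sigma> t" using stable_iff[OF t] qst[OF t] q by simp
    have "0 \<in> {0..T}" using \<open>T > 0\<close> by simp
    then show "W (\<epsilon> t) (z t) - ereal (ddot (\<sigma> t) (\<epsilon> t)) + Diss D z 0 t
          = W (\<epsilon> 0) (z 0) - ereal (ddot (\<sigma> 0) (\<epsilon> 0))
              - ereal (LINT s:{0..t}|lebesgue. ddot (\<sigma>' s) (\<epsilon> s))"
      unfolding energy[OF t] energy[OF \<open>0 \<in> {0..T}\<close>] Diss[OF t] LINT[OF t] by (simp add: G_def)
  qed
  moreover have "(\<lambda>t. (\<epsilon> t, z t)) \<in> W11 T (Sym \<times> Dev)"
  proof -
    have "(\<lambda>r. norm (l' r) / (min c c2 / 3)) integrable_on {0..T}"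
      using l' by (intro integrable_on_divide) (simp add: absolutely_integrable_on_def)
    then obtain v where v: "v absolutely_integrable_on {0..T}"
      "\<And>s t. 0 \<le> s \<Longrightarrow> s \<le> t \<Longrightarrow> t \<le> T \<Longrightarrow> q t - q s = integral {s..t} v"
      using density_of_dominated_increments[OF \<open>T > 0\<close> _ _ qlip] c \<open>c2 > 0\<close> by auto
    have "weak_derivative T q v"
      by (rule weak_derivative_indefinite_integral[OF \<open>T > 0\<close> v])
    then have "q \<in> W11 T (Sym \<times> Dev)"
      using qcont \<epsilon>z q by (auto simp: W11_def)
    then show ?thesis by (simp flip: q)
  qed
  ultimately show ?thesis
    using q0 by (intro exI[of _ \<epsilon>] exI[of _ z]) (simp add: \<epsilon>_def z_def)
qed

end
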